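(* Let $k$ be a positive semi-definite kernel on a metric measure space $\mathcal{M}$ with reproducing kernel Hilbert space $\mathcal{H}_k$, let $\mathcal{X}\subseteq\mathcal{M}$ be compact with finite measure, and let $f\sim\mathcal{GP}(0,k)$ be jointly measurable with sample paths in $L^2(\mathcal{X})$ almost surely. Let $\tilde f$ be a (fixed) standard normal Bayesian linear model with $\ell$ basis functions $\phi_1,\dots,\phi_\ell$, each of which lies locally in $\mathcal{H}_k$ for $\mathcal{X}$. For a finite set $X_n\subset\mathcal{X}$ of $n$ points with $K_{n,n}=k(X_n,X_n)$ invertible and $y\in\mathbb{R}^n$, define $$(f\mid y)(\cdot)=f(\cdot)+k(\cdot,X_n)K_{n,n}^{-1}(y-f(X_n)),\qquad (\tilde f\mid y)(\cdot)=\tilde f(\cdot)+k(\cdot,X_n)K_{n,n}^{-1}(y-\tilde f(X_n)).$$ Then, along any sequence of such finite sets $X_n$ (and vectors $y$) for which $\sup_{x\in\mathcal{X}}k^{(f\mid y)}(x,x)\to0$, one has $$W_{2,L^2(\mathcal{X})}\bigl(f\mid y,\ \tilde f\mid y\bigr)\to0 .$$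
   Context: A standard normal Bayesian linear model is a random function $\tilde f(\cdot)=\sum_{i=1}^\ell w_i\phi_i(\cdot)$ with i.i.d. $w_i\sim\mathcal{N}(0,1)$ and linearly independent (deterministic) basis functions $\phi_i:\mathcal{M}\to\mathbb{R}$. A function $\phi_i$ lies locally in $\mathcal{H}_k$ for $\mathcal{X}$ if there is $\psi\in\mathcal{H}_k$ with $\psi|_{\mathcal{X}}=\phi_i|_{\mathcal{X}}$. For $X_n=(x_1,\dots,x_n)$: $k(\cdot,X_n)=(k(\cdot,x_1),\dots,k(\cdot,x_n))$, $k(X_n,X_n)=(k(x_i,x_j))_{i,j}$, $f(X_n)=(f(x_1),\dots,f(x_n))^\top$. The process $f\mid y$ is (in distribution) $f$ conditioned on the noise-free observations $f(X_n)=y$; $\tilde f\mid y$ applies the same update (with the true kernel $k$) to $\tilde f$. $k^{(f\mid y)}(x,x')=k(x,x')-k(x,X_n)K_{n,n}^{-1}k(X_n,x')$ is the covariance function of $f\mid y$. $L^2(\mathcal{X})$ is taken with respect to the (finite) measure on $\mathcal{X}$ inherited from $\mathcal{M}$. For processes $g,h$ with paths in $L^2(\mathcal{X})$, $W_{2,L^2(\mathcal{X})}(g,h)=\bigl(\inf_\pi\mathbb{E}_{(g',h')\sim\pi}\|g'-h'\|_{L^2(\mathcal{X})}^2\bigr)^{1/2}$, the infimum being over all couplings $\pi$ of the laws of $g$ and $h$ on $L^2(\mathcal{X})$. *)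

theory Defs
  imports "HOL-Probability.Probability" "Jordan_Normal_Form.Gauss_Jordan_Elimination"
begin

section \<open>The metric space \<open>L\<^sup>2\<close>\<close>

text \<open>
  A point of \<open>L\<^sup>2(N)\<close> is an equivalence class, modulo equality almost everywhere, of
  square-integrable functions.  For \<open>N = restrict_space \<mu> X\<close> all conditions concern only
  the restrictions of the functions to \<open>X\<close>.
\<close>

definition sq_integrable :: "'a measure \<Rightarrow> ('a \<Rightarrow> real) set" where
  "sq_integrable N = {g \<in> borel_measurable N. integrable N (\<lambda>x. (g x)\<^sup>2)}"

definition l2_class :: "'a measure \<Rightarrow> ('a \<Rightarrow> real) \<Rightarrow> ('a \<Rightarrow> real) set" where
  "l2_class N g = {h \<in> sq_integrable N. AE x in N. h x = g x}"

definition L2 :: "'a measure \<Rightarrow> ('a \<Rightarrow> real) set set" where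
  "L2 N = l2_class N ` sq_integrable N"

definition l2_norm :: "'a measure \<Rightarrow> ('a \<Rightarrow> real) \<Rightarrow> real" where
  "l2_norm N g = sqrt (LINT x|N. (g x)\<^sup>2)"

definition l2_dist :: "'a measure \<Rightarrow> ('a \<Rightarrow> real) set \<Rightarrow> ('a \<Rightarrow> real) set \<Rightarrow> real" where
  "l2_dist N U V = l2_norm N (\<lambda>x. (SOME g. g \<in> U) x - (SOME h. h \<in> V) x)"

definition L2_borel :: "'a measure \<Rightarrow> ('a \<Rightarrow> real) set measure" where
  "L2_borel N = sigma (L2 N) {U. openin (Metric_space.mtopology (L2 N) (l2_dist N)) U}"

lemma sq_integrable_add:
  assumes "g \<in> sq_integrable N" "h \<in> sq_integrable N"
  shows "(\<lambda>x. g x + h x) \<in> sq_integrable N"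
proof -
  have [measurable]: "g \<in> borel_measurable N" "h \<in> borel_measurable N"
    using assms by (auto simp: sq_integrable_def)
  have i: "integrable N (\<lambda>x. 2 * (g x)\<^sup>2 + 2 * (h x)\<^sup>2)"
    using assms by (auto simp: sq_integrable_def)
  have b: "(a + b)\<^sup>2 \<le> 2 * a\<^sup>2 + 2 * b\<^sup>2" for a b :: real
    using zero_le_power2[of "a - b"] by (simp add: power2_eq_square algebra_simps)
  have "integrable N (\<lambda>x. (g x + h x)\<^sup>2)"
    by (rule Bochner_Integration.integrable_bound[OF i]) (use b in auto)
  then show ?thesis by (simp add: sq_integrable_def)
qed

lemma sq_integrable_diff:
  assumes "g \<in> sq_integrable N" "h \<in> sq_integrable N"
  shows "(\<lambda>x. g x - h x) \<in> sq_integrable N"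
proof -
  have "(\<lambda>x. - h x) \<in> sq_integrable N"
    using assms by (auto simp: sq_integrable_def)
  from sq_integrable_add[OF assms(1) this] show ?thesis by simp
qed

lemma l2_norm_cong:
  assumes "AE x in N. g x = h x" "g \<in> sq_integrable N" "h \<in> sq_integrable N"
  shows "l2_norm N g = l2_norm N h"
proof -
  have [measurable]: "g \<in> borel_measurable N" "h \<in> borel_measurable N"
    using assms by (auto simp: sq_integrable_def)
  have "(LINT x|N. (g x)\<^sup>2) = (LINT x|N. (h x)\<^sup>2)"
    by (rule integral_cong_AE) (use assms(1) in auto)
  then show ?thesis by (simp add: l2_norm_def)
qed

lemma l2_norm_eq_0_iff:
  assumes "g \<in> sq_integrable N"
  shows "l2_norm N g = 0 \<longleftrightarrow> (AE x in N. g x = 0)"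
  using assms integral_nonneg_eq_0_iff_AE[of N "\<lambda>x. (g x)\<^sup>2"]
  by (simp add: l2_norm_def sq_integrable_def)

lemma l2_norm_triangle:
  assumes g: "g \<in> sq_integrable N" and h: "h \<in> sq_integrable N"
  shows "l2_norm N (\<lambda>x. g x + h x) \<le> l2_norm N g + l2_norm N h"
proof -
  have gh: "(\<lambda>x. g x + h x) \<in> sq_integrable N"
    by (rule sq_integrable_add[OF g h])
  define a b where "a = l2_norm N g" and "b = l2_norm N h"
  have a2: "(LINT x|N. (g x)\<^sup>2) = a\<^sup>2" and b2: "(LINT x|N. (h x)\<^sup>2) = b\<^sup>2"
    and a0: "a \<ge> 0" and b0: "b \<ge> 0"
    by (auto simp: a_def b_def l2_norm_def)
  consider "a = 0" | "b = 0" | "a > 0" "b > 0" using a0 b0 by linarith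
  then show ?thesis
  proof cases
    case 1
    then have "AE x in N. g x = 0" using l2_norm_eq_0_iff[OF g] by (simp add: a_def)
    then have "AE x in N. g x + h x = h x" by eventually_elim simp
    from l2_norm_cong[OF this gh h] show ?thesis using a0 by (simp add: a_def)
  next
    case 2
    then have "AE x in N. h x = 0" using l2_norm_eq_0_iff[OF h] by (simp add: b_def)
    then have "AE x in N. g x + h x = g x" by eventually_elim simp
    from l2_norm_cong[OF this gh g] show ?thesis using b0 by (simp add: b_def)
  next
    case 3
    have p: "(u + v)\<^sup>2 \<le> (1 + b / a) * u\<^sup>2 + (1 + a / b) * v\<^sup>2" for u v :: real
    proof -
      have "(1 + b / a) * u\<^sup>2 + (1 + a / b) * v\<^sup>2 - (u + v)\<^sup>2 = (b * u - a * v)\<^sup>2 / (a * b)"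
        using 3 by (simp add: field_simps power2_eq_square)
      moreover have "(b * u - a * v)\<^sup>2 / (a * b) \<ge> 0" using 3 by simp
      ultimately show ?thesis by linarith
    qed
    have "(LINT x|N. (g x + h x)\<^sup>2)
        \<le> (LINT x|N. (1 + b / a) * (g x)\<^sup>2 + (1 + a / b) * (h x)\<^sup>2)"
      using g h gh p by (intro integral_mono) (auto simp: sq_integrable_def)
    also have "\<dots> = (1 + b / a) * a\<^sup>2 + (1 + a / b) * b\<^sup>2"
      using g h by (simp add: sq_integrable_def a2 b2)
    also have "\<dots> = (a + b)\<^sup>2"
      using 3 by (simp add: field_simps power2_eq_square)
    finally have "(LINT x|N. (g x + h x)\<^sup>2) \<le> (a + b)\<^sup>2" .
    then show ?thesis
      using a0 b0 by (auto simp: l2_norm_def a_def b_def intro: real_le_lsqrt)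
  qed
qed

lemma L2_cases:
  assumes "U \<in> L2 N"
  obtains g where "g \<in> sq_integrable N" "U = l2_class N g"
  using assms by (auto simp: L2_def)

lemma l2_class_eq_iff:
  assumes "g \<in> sq_integrable N" "h \<in> sq_integrable N"
  shows "l2_class N g = l2_class N h \<longleftrightarrow> (AE x in N. g x = h x)"
proof
  assume "l2_class N g = l2_class N h"
  moreover have "g \<in> l2_class N g" using assms by (simp add: l2_class_def)
  ultimately show "AE x in N. g x = h x" by (auto simp: l2_class_def)
next
  assume *: "AE x in N. g x = h x"
  have "(AE x in N. u x = g x) \<longleftrightarrow> (AE x in N. u x = h x)" for u
  proof
    assume "AE x in N. u x = g x" with * show "AE x in N. u x = h x" by eventually_elim simp
  next
    assume "AE x in N. u x = h x" with * show "AE x in N. u x = g x" by eventually_elim simp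
  qed
  then show "l2_class N g = l2_class N h" by (auto simp: l2_class_def)
qed

lemma l2_dist_class:
  assumes g: "g \<in> sq_integrable N" and h: "h \<in> sq_integrable N"
  shows "l2_dist N (l2_class N g) (l2_class N h) = l2_norm N (\<lambda>x. g x - h x)"
proof -
  define g' h' where "g' = (SOME u. u \<in> l2_class N g)" and "h' = (SOME u. u \<in> l2_class N h)"
  have "g \<in> l2_class N g" "h \<in> l2_class N h" using g h by (auto simp: l2_class_def)
  then have "g' \<in> l2_class N g" "h' \<in> l2_class N h" unfolding g'_def h'_def by (metis someI)+
  then have g': "g' \<in> sq_integrable N" "AE x in N. g' x = g x"
    and h': "h' \<in> sq_integrable N" "AE x in N. h' x = h x"
    by (auto simp: l2_class_def)
  have "AE x in N. g' x - h' x = g x - h x"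
    using g'(2) h'(2) by eventually_elim simp
  from l2_norm_cong[OF this sq_integrable_diff[OF g'(1) h'(1)] sq_integrable_diff[OF g h]]
  show ?thesis by (simp add: l2_dist_def g'_def h'_def)
qed

lemma Metric_space_L2: "Metric_space (L2 N) (l2_dist N)"
proof
  fix U V show "0 \<le> l2_dist N U V" by (simp add: l2_dist_def l2_norm_def)
next
  fix U V show "l2_dist N U V = l2_dist N V U"
    by (simp add: l2_dist_def l2_norm_def power2_commute)
next
  fix U V assume "U \<in> L2 N" "V \<in> L2 N"
  then obtain g h where g: "g \<in> sq_integrable N" "U = l2_class N g"
    and h: "h \<in> sq_integrable N" "V = l2_class N h"
    by (meson L2_cases)
  show "l2_dist N U V = 0 \<longleftrightarrow> U = V"
    unfolding g(2) h(2) l2_dist_class[OF g(1) h(1)] l2_class_eq_iff[OF g(1) h(1)]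
      l2_norm_eq_0_iff[OF sq_integrable_diff[OF g(1) h(1)]] by simp
next
  fix U V W assume "U \<in> L2 N" "V \<in> L2 N" "W \<in> L2 N"
  then obtain f g h where f: "f \<in> sq_integrable N" "U = l2_class N f"
    and g: "g \<in> sq_integrable N" "V = l2_class N g"
    and h: "h \<in> sq_integrable N" "W = l2_class N h"
    by (meson L2_cases)
  show "l2_dist N U W \<le> l2_dist N U V + l2_dist N V W"
    using l2_norm_triangle[OF sq_integrable_diff[OF f(1) g(1)] sq_integrable_diff[OF g(1) h(1)]]
    by (simp add: f g h l2_dist_class)
qed

section \<open>Random functions and the Wasserstein distance\<close>

text \<open>
  A random function on the probability space \<open>P\<close> maps \<open>\<omega>\<close> to the path \<open>f \<omega>\<close>.
  Its law on \<open>L\<^sup>2(N)\<close> is used for processes with almost all paths in \<open>L\<^sup>2(N)\<close>; on the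
  exceptional null set the path is replaced by 0.
\<close>

definition l2_law :: "'w measure \<Rightarrow> 'a measure \<Rightarrow> ('w \<Rightarrow> 'a \<Rightarrow> real) \<Rightarrow> ('a \<Rightarrow> real) set measure" where
  "l2_law P N f = distr P (L2_borel N)
     (\<lambda>\<omega>. l2_class N (if f \<omega> \<in> sq_integrable N then f \<omega> else (\<lambda>_. 0)))"

definition couplings :: "'b measure \<Rightarrow> 'c measure \<Rightarrow> ('b \<times> 'c) measure set" where
  "couplings A B = {\<pi>. prob_space \<pi> \<and> sets \<pi> = sets (A \<Otimes>\<^sub>M B) \<and> distr \<pi> A fst = A \<and> distr \<pi> B snd = B}"

definition ennreal_sqrt :: "ennreal \<Rightarrow> ennreal" where
  "ennreal_sqrt t = (if t = \<infinity> then \<infinity> else ennreal (sqrt (enn2real t)))"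

definition wasserstein2 :: "('b \<Rightarrow> 'b \<Rightarrow> real) \<Rightarrow> 'b measure \<Rightarrow> 'b measure \<Rightarrow> ennreal" where
  "wasserstein2 d A B =
     ennreal_sqrt (INF \<pi>\<in>couplings A B. \<integral>\<^sup>+ (u, v). ennreal ((d u v)\<^sup>2) \<partial>\<pi>)"

text \<open>The two processes may live on different probability spaces.\<close>

definition W2_L2 ::
  "'a measure \<Rightarrow> 'v measure \<Rightarrow> ('v \<Rightarrow> 'a \<Rightarrow> real) \<Rightarrow> 'w measure \<Rightarrow> ('w \<Rightarrow> 'a \<Rightarrow> real) \<Rightarrow> ennreal" where
  "W2_L2 N P g Q h = wasserstein2 (l2_dist N) (l2_law P N g) (l2_law Q N h)"

section \<open>Kernels and reproducing kernel Hilbert spaces\<close>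

definition psd_kernel :: "('a \<Rightarrow> 'a \<Rightarrow> real) \<Rightarrow> bool" where
  "psd_kernel k \<longleftrightarrow> (\<forall>x x'. k x x' = k x' x) \<and>
     (\<forall>S c. finite S \<longrightarrow> 0 \<le> (\<Sum>x\<in>S. \<Sum>x'\<in>S. c x * c x' * k x x'))"

text \<open>
  \<open>rkhs k H ip\<close>: the set \<open>H\<close> of functions with inner product \<open>ip\<close> is a Hilbert space with
  reproducing kernel \<open>k\<close>.  By the Moore-Aronszajn theorem, such \<open>H\<close> and \<open>ip\<close> (on \<open>H\<close>) exist
  and are unique for every positive semi-definite \<open>k\<close>.
\<close>

locale rkhs =
  fixes k :: "'a \<Rightarrow> 'a \<Rightarrow> real"
    and H :: "('a \<Rightarrow> real) set"
    and ip :: "('a \<Rightarrow> real) \<Rightarrow> ('a \<Rightarrow> real) \<Rightarrow> real"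
  assumes zero: "(\<lambda>_. 0) \<in> H"
    and add: "\<lbrakk>g \<in> H; h \<in> H\<rbrakk> \<Longrightarrow> (\<lambda>x. g x + h x) \<in> H"
    and scale: "g \<in> H \<Longrightarrow> (\<lambda>x. c * g x) \<in> H"
    and ip_commute: "\<lbrakk>g \<in> H; h \<in> H\<rbrakk> \<Longrightarrow> ip g h = ip h g"
    and ip_add: "\<lbrakk>g \<in> H; g' \<in> H; h \<in> H\<rbrakk> \<Longrightarrow> ip (\<lambda>x. g x + g' x) h = ip g h + ip g' h"
    and ip_scale: "\<lbrakk>g \<in> H; h \<in> H\<rbrakk> \<Longrightarrow> ip (\<lambda>x. c * g x) h = c * ip g h"
    and ip_nonneg: "g \<in> H \<Longrightarrow> 0 \<le> ip g g"
    and ip_eq_0: "\<lbrakk>g \<in> H; ip g g = 0\<rbrakk> \<Longrightarrow> g = (\<lambda>_. 0)"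
    and complete: "\<lbrakk>\<And>n. s n \<in> H;
        \<And>e. 0 < e \<Longrightarrow> \<exists>M. \<forall>m\<ge>M. \<forall>n\<ge>M. sqrt (ip (\<lambda>x. s m x - s n x) (\<lambda>x. s m x - s n x)) < e\<rbrakk>
      \<Longrightarrow> \<exists>g\<in>H. (\<lambda>n. sqrt (ip (\<lambda>x. s n x - g x) (\<lambda>x. s n x - g x))) \<longlonglongrightarrow> 0"
    and kernel_mem: "(\<lambda>x'. k x' x) \<in> H"
    and reproducing: "g \<in> H \<Longrightarrow> ip g (\<lambda>x'. k x' x) = g x"

definition lies_locally_in :: "('a \<Rightarrow> real) \<Rightarrow> ('a \<Rightarrow> real) set \<Rightarrow> 'a set \<Rightarrow> bool" where
  "lies_locally_in g H X \<longleftrightarrow> (\<exists>\<psi>\<in>H. \<forall>x\<in>X. \<psi> x = g x)"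

section \<open>Gaussian processes and Bayesian linear models\<close>

definition normal_law :: "real \<Rightarrow> real \<Rightarrow> real measure" where
  "normal_law m v = (if v = 0 then return borel m else density lborel (normal_density m (sqrt v)))"

text \<open>
  The finite-dimensional distributions of a Gaussian process with mean \<open>m\<close> and covariance \<open>k\<close>
  are multivariate normal, i.e. each linear combination of the coordinates is normal (possibly
  degenerate) with the mean and the variance dictated by \<open>m\<close> and \<open>k\<close>.
\<close>

definition gaussian_process ::
  "'w measure \<Rightarrow> ('w \<Rightarrow> 'a \<Rightarrow> real) \<Rightarrow> ('a \<Rightarrow> real) \<Rightarrow> ('a \<Rightarrow> 'a \<Rightarrow> real) \<Rightarrow> bool" where
  "gaussian_process P f m k \<longleftrightarrow> prob_space P \<and>
     (\<forall>x. (\<lambda>\<omega>. f \<omega> x) \<in> borel_measurable P) \<and>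
     (\<forall>S c. finite S \<longrightarrow>
        distr P borel (\<lambda>\<omega>. \<Sum>x\<in>S. c x * f \<omega> x) =
        normal_law (\<Sum>x\<in>S. c x * m x) (\<Sum>x\<in>S. \<Sum>x'\<in>S. c x * c x' * k x x'))"

definition std_normal_blm ::
  "'w measure \<Rightarrow> nat \<Rightarrow> (nat \<Rightarrow> 'a \<Rightarrow> real) \<Rightarrow> ('w \<Rightarrow> 'a \<Rightarrow> real) \<Rightarrow> bool" where
  "std_normal_blm Q l \<phi> f \<longleftrightarrow> prob_space Q \<and>
     (\<forall>c. (\<forall>x. (\<Sum>i<l. c i * \<phi> i x) = 0) \<longrightarrow> (\<forall>i<l. c i = 0)) \<and>
     (\<exists>w. prob_space.indep_vars Q (\<lambda>_. borel) w {..<l} \<and>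
          (\<forall>i<l. distributed Q lborel (w i) (normal_density 0 1)) \<and>
          f = (\<lambda>\<omega> x. \<Sum>i<l. w i \<omega> * \<phi> i x))"

section \<open>Conditioning on noise-free observations\<close>

definition gram :: "('a \<Rightarrow> 'a \<Rightarrow> real) \<Rightarrow> 'a list \<Rightarrow> real mat" where
  "gram k xs = mat (length xs) (length xs) (\<lambda>(i, j). k (xs ! i) (xs ! j))"

definition gram_inv :: "('a \<Rightarrow> 'a \<Rightarrow> real) \<Rightarrow> 'a list \<Rightarrow> real mat" where
  "gram_inv k xs = the (mat_inverse (gram k xs))"

definition pathwise_update ::
  "('a \<Rightarrow> 'a \<Rightarrow> real) \<Rightarrow> 'a list \<Rightarrow> real Matrix.vec \<Rightarrow> ('a \<Rightarrow> real) \<Rightarrow> 'a \<Rightarrow> real" where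
  "pathwise_update k xs y g x =
     g x + scalar_prod (vec_of_list (map (k x) xs))
             (gram_inv k xs *\<^sub>v (y - vec_of_list (map g xs)))"

text \<open>
  For positive semi-definite \<open>k\<close> and invertible \<open>gram k xs\<close>, \<open>post_cov k xs x x\<close> is a Schur
  complement of a Gram matrix, hence nonnegative; embedding it into \<open>ennreal\<close> loses nothing.
\<close>

definition post_cov :: "('a \<Rightarrow> 'a \<Rightarrow> real) \<Rightarrow> 'a list \<Rightarrow> 'a \<Rightarrow> 'a \<Rightarrow> real" where
  "post_cov k xs x x' =
     k x x' - scalar_prod (vec_of_list (map (k x) xs))
                (gram_inv k xs *\<^sub>v vec_of_list (map (\<lambda>z. k z x') xs))"

lemma gram_inv:
  assumes "invertible_mat (gram k xs)"
  shows "gram_inv k xs \<in> carrier_mat (length xs) (length xs)"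
    and "gram k xs * gram_inv k xs = 1\<^sub>m (length xs)"
    and "gram_inv k xs * gram k xs = 1\<^sub>m (length xs)"
proof -
  let ?n = "length xs" and ?K = "gram k xs"
  have K: "?K \<in> carrier_mat ?n ?n" by (simp add: gram_def)
  obtain B where B: "?K * B = 1\<^sub>m ?n" "B * ?K = 1\<^sub>m (dim_row B)"
    using assms K by (auto simp: invertible_mat_def inverts_mat_def)
  have c: "dim_col B = ?n" using arg_cong[OF B(1), of dim_col] by simp
  have r: "dim_row B = ?n" using arg_cong[OF B(2), of dim_col] K by simp
  have "B \<in> carrier_mat ?n ?n" using c r by auto
  with B r K have "?K \<in> Units (ring_mat TYPE(real) ?n ())"
    unfolding Units_def ring_mat_def by auto
  with mat_inverse(1)[OF K, of "()"] obtain C where "mat_inverse ?K = Some C" by (cases "mat_inverse ?K") auto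
  with mat_inverse(2)[OF K this]
  show "gram_inv k xs \<in> carrier_mat ?n ?n" "?K * gram_inv k xs = 1\<^sub>m ?n" "gram_inv k xs * ?K = 1\<^sub>m ?n"
    by (auto simp: gram_inv_def)
qed

end

theory Submission
  imports Defs
begin

text \<open>
  Couple the two processes independently.  Both updates add the same deterministic function to the
  residual \<open>R g = g - k(\<cdot>, X\<^sub>n) K\<^sup>-\<^sup>1 g(X\<^sub>n)\<close> of the prior path, so the squared distance
  is at most \<open>2 \<parallel>R f\<parallel>\<^sup>2 + 2 \<parallel>R f'\<parallel>\<^sup>2\<close>.  At a point \<open>x\<close> the expectation of \<open>(R f)(x)\<^sup>2\<close> is the
  posterior variance \<open>v x\<close>, while in the RKHS \<open>(R \<psi>)(x)\<^sup>2 \<le> \<parallel>\<psi>\<parallel>\<^sup>2 v x\<close> by Cauchy-Schwarz, since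
  \<open>v x\<close> is the squared norm of the representer of \<open>\<psi> \<mapsto> (R \<psi>)(x)\<close>.  Integrating over \<open>X\<close> bounds
  the squared Wasserstein distance by a constant times \<open>sup v\<close>.

  The laws on \<open>L\<^sup>2\<close> are probability measures only if the processes are Borel measurable as maps
  into \<open>L\<^sup>2\<close>; this follows from Tonelli once \<open>L\<^sup>2\<close> is known to be separable, which holds because
  the Borel sets of a compact metric space are countably generated.
\<close>

section \<open>Separability of \<open>L\<^sup>2\<close>\<close>

text \<open>A compact metric space is totally bounded, so the balls of radius 1/(n+1) around finite
  nets form a countable base, and their finite intersections form a countable pi-system. Stability
  under intersection is what the Dynkin argument in \<open>L2_separable\<close> asks for.\<close>

lemma compact_borel_generator:
  fixes X :: "'a :: metric_space set"
  assumes "compact X"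
  obtains C where "countable C" "Int_stable C" "X \<in> C" "C \<subseteq> Pow X"
    "sets (restrict_space borel X) = sigma_sets X C"
proof -
  have "\<forall>n. \<exists>F. finite F \<and> F \<subseteq> X \<and> X \<subseteq> (\<Union>p\<in>F. ball p (1 / real (Suc n)))"
    using seq_compact_imp_totally_bounded[OF compact_imp_seq_compact[OF assms]] by simp
  then obtain F where F: "\<And>n. finite (F n)" "\<And>n. F n \<subseteq> X"
    "\<And>n. X \<subseteq> (\<Union>p\<in>F n. ball p (1 / real (Suc n)))"
    by metis
  define B where "B = (\<Union>n. (\<lambda>p. ball p (1 / real (Suc n))) ` F n)"
  \<comment> \<open>The empty family \<open>G\<close> contributes \<open>X\<close> itself.\<close>
  define C where "C = (\<lambda>G. X \<inter> \<Inter>G) ` {G. finite G \<and> G \<subseteq> B}"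
  have B: "countable B" unfolding B_def using F(1) by (auto intro: countable_finite)
  have openB: "open b" if "b \<in> B" for b using that by (auto simp: B_def)
  have "countable C"
    unfolding C_def by (intro countable_image countable_Collect_finite_subset B)
  moreover have "Int_stable C"
  proof (rule Int_stableI)
    fix a b assume "a \<in> C" "b \<in> C"
    then obtain G G' where "finite G" "G \<subseteq> B" "finite G'" "G' \<subseteq> B"
      "a = X \<inter> \<Inter>G" "b = X \<inter> \<Inter>G'" by (auto simp: C_def)
    then have "a \<inter> b = X \<inter> \<Inter>(G \<union> G')" "finite (G \<union> G')" "G \<union> G' \<subseteq> B" by auto
    then show "a \<inter> b \<in> C" unfolding C_def by blast
  qed
  moreover have "X \<in> C" unfolding C_def by (rule image_eqI[of _ _ "{}"]) auto
  moreover have CX: "C \<subseteq> Pow X" by (auto simp: C_def)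
  moreover have BC: "X \<inter> b \<in> C" if "b \<in> B" for b
    unfolding C_def by (rule image_eqI[of _ _ "{b}"]) (use that in auto)
  have "sets (restrict_space borel X) = sigma_sets X C"
  proof
    have "X \<inter> S \<in> sigma_sets X C" if "S \<in> sigma_sets UNIV {S. open S}" for S
      using that
    proof induction
      case (Basic S)
      \<comment> \<open>The balls form a base on \<open>X\<close>: if \<open>x\<close> lies in a
        ball of radius 1/(n+1) with 2/(n+1) < e, that ball stays within distance e of
        \<open>x\<close>. Countability of \<open>B\<close> then makes the union admissible.\<close>
      have "X \<inter> S = (\<Union>b\<in>{b\<in>B. X \<inter> b \<subseteq> S}. X \<inter> b)"
      proof safe
        fix x assume x: "x \<in> X" "x \<in> S"
        then obtain e where e: "e > 0" "ball x e \<subseteq> S"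
          using Basic openE by blast
        obtain n where n: "2 / real (Suc n) < e"
          using reals_Archimedean[of "e / 2"] e by (auto simp: field_simps)
        obtain p where p: "p \<in> F n" "x \<in> ball p (1 / real (Suc n))" using F(3)[of n] x by blast
        have "ball p (1 / real (Suc n)) \<subseteq> ball x e"
        proof
          fix z assume "z \<in> ball p (1 / real (Suc n))"
          then have "dist x z < 1 / real (Suc n) + 1 / real (Suc n)"
            using p(2) dist_triangle[of x z p] by (simp add: dist_commute)
          then show "z \<in> ball x e" using n by simp
        qed
        with e have "X \<inter> ball p (1 / real (Suc n)) \<subseteq> S" by blast
        moreover have "ball p (1 / real (Suc n)) \<in> B" unfolding B_def using p(1) by blast
        ultimately show "x \<in> (\<Union>b\<in>{b\<in>B. X \<inter> b \<subseteq> S}. X \<inter> b)" using x p(2) by blast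
      qed auto
      moreover have "(\<Union>b\<in>{b\<in>B. X \<inter> b \<subseteq> S}. X \<inter> b) \<in> sigma_sets X C"
        by (rule sigma_sets_UNION) (auto intro!: countable_image countable_Collect B BC)
      ultimately show ?case by simp
    next
      case Empty then show ?case by (simp add: sigma_sets.Empty)
    next
      case (Compl S)
      have "X \<inter> (UNIV - S) = X - X \<inter> S" by auto
      then show ?case using Compl sigma_sets.Compl by metis
    next
      case (Union S)
      have "X \<inter> (\<Union>i. S i) = (\<Union>i. X \<inter> S i)" by auto
      then show ?case using Union sigma_sets.Union[of "\<lambda>i. X \<inter> S i"] by metis
    qed
    then show "sets (restrict_space borel X) \<subseteq> sigma_sets X C"
      by (auto simp: sets_restrict_space borel_def sets_measure_of)
    have "X \<inter> \<Inter>G \<in> sets (restrict_space borel X)" if "finite G" "G \<subseteq> B" for G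
      unfolding sets_restrict_space
      using that openB by (intro imageI borel_open open_Inter) auto
    then have "C \<subseteq> sets (restrict_space borel X)" unfolding C_def by auto
    then show "sigma_sets X C \<subseteq> sets (restrict_space borel X)"
      using sets.sigma_sets_subset[of C "restrict_space borel X"] by (simp add: space_restrict_space)
  qed
  ultimately show thesis using that by blast
qed

section \<open>Closure of a set of functions in the L2 seminorm\<close>

lemma l2_norm_scale: "l2_norm N (\<lambda>x. c * g x) = \<bar>c\<bar> * l2_norm N g"
  by (simp add: l2_norm_def power_mult_distrib real_sqrt_mult)

lemma l2_norm_nonneg [simp]: "0 \<le> l2_norm N g"
  by (simp add: l2_norm_def)

lemma sq_integrable_scale:
  assumes "g \<in> sq_integrable N" shows "(\<lambda>x. c * g x) \<in> sq_integrable N"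
  using assms by (auto simp: sq_integrable_def power_mult_distrib)

lemma sq_integrable_bound:
  assumes "g \<in> sq_integrable N" "h \<in> borel_measurable N" "\<And>x. x \<in> space N \<Longrightarrow> \<bar>h x\<bar> \<le> \<bar>g x\<bar>"
  shows "h \<in> sq_integrable N"
  using assms Bochner_Integration.integrable_bound[of N "\<lambda>x. (g x)\<^sup>2" "\<lambda>x. (h x)\<^sup>2"]
  by (auto simp: sq_integrable_def abs_le_square_iff)

text \<open>Membership in the closure of \<open>D\<close>. Square integrability is bundled in, so
  that each closure property also delivers the integrability of the new function.\<close>

definition l2_approx :: "'a measure \<Rightarrow> ('a \<Rightarrow> real) set \<Rightarrow> ('a \<Rightarrow> real) \<Rightarrow> bool" where
  "l2_approx N D g \<longleftrightarrow> g \<in> sq_integrable N \<and> (\<forall>e>0. \<exists>d\<in>D. l2_norm N (\<lambda>x. g x - d x) < e)"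

lemma l2_approx_trans:
  assumes D: "D \<subseteq> sq_integrable N" and g: "g \<in> sq_integrable N"
    and *: "\<And>e. e > 0 \<Longrightarrow> \<exists>h. l2_approx N D h \<and> l2_norm N (\<lambda>x. g x - h x) < e"
  shows "l2_approx N D g"
  unfolding l2_approx_def
proof (intro conjI allI impI g)
  fix e :: real assume "e > 0"
  then obtain h where h: "l2_approx N D h" "l2_norm N (\<lambda>x. g x - h x) < e / 2"
    using *[of "e / 2"] by auto
  then obtain d where d: "d \<in> D" "l2_norm N (\<lambda>x. h x - d x) < e / 2"
    using \<open>e > 0\<close> unfolding l2_approx_def by (meson half_gt_zero)
  have hs: "h \<in> sq_integrable N" using h by (simp add: l2_approx_def)
  have "l2_norm N (\<lambda>x. g x - d x) \<le> l2_norm N (\<lambda>x. g x - h x) + l2_norm N (\<lambda>x. h x - d x)"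
    using l2_norm_triangle[OF sq_integrable_diff[OF g hs] sq_integrable_diff[OF hs subsetD[OF D d(1)]]]
    by simp
  with h d show "\<exists>d\<in>D. l2_norm N (\<lambda>x. g x - d x) < e" by (intro bexI[of _ d]) auto
qed

lemma l2_approx_add:
  assumes D: "D \<subseteq> sq_integrable N" and gh: "l2_approx N D g" "l2_approx N D h"
    and add: "\<And>d d'. d \<in> D \<Longrightarrow> d' \<in> D \<Longrightarrow> (\<lambda>x. d x + d' x) \<in> D"
  shows "l2_approx N D (\<lambda>x. g x + h x)"
  unfolding l2_approx_def
proof (intro conjI allI impI)
  have g: "g \<in> sq_integrable N" and h: "h \<in> sq_integrable N"
    using gh by (auto simp: l2_approx_def)
  show "(\<lambda>x. g x + h x) \<in> sq_integrable N" by (rule sq_integrable_add[OF g h])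
  fix e :: real assume "e > 0"
  then obtain d d' where d: "d \<in> D" "l2_norm N (\<lambda>x. g x - d x) < e / 2"
     "d' \<in> D" "l2_norm N (\<lambda>x. h x - d' x) < e / 2"
    using gh unfolding l2_approx_def by (meson half_gt_zero)
  have "l2_norm N (\<lambda>x. (g x - d x) + (h x - d' x))
      \<le> l2_norm N (\<lambda>x. g x - d x) + l2_norm N (\<lambda>x. h x - d' x)"
    by (rule l2_norm_triangle) (use D d g h in \<open>auto intro: sq_integrable_diff\<close>)
  then have "l2_norm N (\<lambda>x. g x + h x - (d x + d' x)) < e"
    using d by (simp add: algebra_simps)
  then show "\<exists>d\<in>D. l2_norm N (\<lambda>x. g x + h x - d x) < e" using add[OF d(1,3)] by (intro bexI[of _ "\<lambda>x. d x + d' x"])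
qed

text \<open>The set \<open>D\<close> is closed only under rational multiples, so \<open>c\<close> is
  replaced by a nearby rational \<open>q\<close> and the error is split as c (g - d) + (c - q)
  d.\<close>

lemma l2_approx_scale:
  assumes D: "D \<subseteq> sq_integrable N" and g: "l2_approx N D g"
    and scale: "\<And>d q. d \<in> D \<Longrightarrow> (\<lambda>x. real_of_rat q * d x) \<in> D"
  shows "l2_approx N D (\<lambda>x. c * g x)"
  unfolding l2_approx_def
proof (intro conjI allI impI)
  have gs: "g \<in> sq_integrable N" using g by (auto simp: l2_approx_def)
  show "(\<lambda>x. c * g x) \<in> sq_integrable N" by (rule sq_integrable_scale[OF gs])
  fix e :: real assume e: "e > 0"
  then have "e / 2 / (\<bar>c\<bar> + 1) > 0" by simp
  then obtain d where d: "d \<in> D" "l2_norm N (\<lambda>x. g x - d x) < e / 2 / (\<bar>c\<bar> + 1)"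
    using g unfolding l2_approx_def by blast
  \<comment> \<open>Each error term receives e/2. The summands 1 in the denominators guard against
    \<open>c = 0\<close> and against \<open>d\<close> of norm 0.\<close>
  define r where "r = e / 2 / (l2_norm N d + 1)"
  have n: "l2_norm N d + 1 > 0" by (smt (verit) l2_norm_nonneg)
  then have r: "r > 0" using e by (simp add: r_def)
  obtain q where q: "c - r < real_of_rat q" "real_of_rat q < c + r"
    using of_rat_dense[of "c - r" "c + r"] r by auto
  have ds: "d \<in> sq_integrable N" using D d by auto
  have "l2_norm N (\<lambda>x. c * (g x - d x) + (c - real_of_rat q) * d x)
      \<le> l2_norm N (\<lambda>x. c * (g x - d x)) + l2_norm N (\<lambda>x. (c - real_of_rat q) * d x)"
    using gs ds by (intro l2_norm_triangle sq_integrable_scale sq_integrable_diff)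
  also have "\<dots> = \<bar>c\<bar> * l2_norm N (\<lambda>x. g x - d x) + \<bar>c - real_of_rat q\<bar> * l2_norm N d"
    by (simp add: l2_norm_scale)
  also have "\<bar>c\<bar> * l2_norm N (\<lambda>x. g x - d x) \<le> (\<bar>c\<bar> + 1) * l2_norm N (\<lambda>x. g x - d x)"
    by (intro mult_right_mono) auto
  also have "(\<bar>c\<bar> + 1) * l2_norm N (\<lambda>x. g x - d x) < e / 2"
    using d(2) by (simp add: field_simps)
  also have "\<bar>c - real_of_rat q\<bar> * l2_norm N d \<le> r * (l2_norm N d + 1)"
    using q r by (intro mult_mono) auto
  also have "r * (l2_norm N d + 1) = e / 2"
    unfolding r_def using n by (intro nonzero_eq_divide_eq[THEN iffD1, OF _ refl]) linarith
  finally have "l2_norm N (\<lambda>x. c * g x - real_of_rat q * d x) < e" by (simp add: algebra_simps)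
  then show "\<exists>d\<in>D. l2_norm N (\<lambda>x. c * g x - d x) < e" using scale[OF d(1), of q] by (intro bexI[of _ "\<lambda>x. real_of_rat q * d x"])
qed

text \<open>Dominated convergence: |u - U i| is at most 2 |u|, so 4 u^2 dominates the squared
  errors.\<close>

lemma l2_approx_limit:
  assumes D: "D \<subseteq> sq_integrable N" and u: "u \<in> sq_integrable N"
    and U: "\<And>i. l2_approx N D (U i)"
    and lim: "\<And>x. x \<in> space N \<Longrightarrow> (\<lambda>i. U i x) \<longlonglongrightarrow> u x"
    and le: "\<And>i x. x \<in> space N \<Longrightarrow> \<bar>U i x\<bar> \<le> \<bar>u x\<bar>"
  shows "l2_approx N D u"
proof (rule l2_approx_trans[OF D u])
  have [measurable]: "U i \<in> borel_measurable N" "u \<in> borel_measurable N" for i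
    using U u by (auto simp: l2_approx_def sq_integrable_def)
  have "(\<lambda>i. LINT x|N. (u x - U i x)\<^sup>2) \<longlonglongrightarrow> (LINT x|N. 0)"
  proof (rule integral_dominated_convergence[where w = "\<lambda>x. 4 * (u x)\<^sup>2"])
    show "integrable N (\<lambda>x. 4 * (u x)\<^sup>2)" using u by (auto simp: sq_integrable_def)
    show "AE x in N. (\<lambda>i. (u x - U i x)\<^sup>2) \<longlonglongrightarrow> 0"
    proof (rule AE_I2)
      fix x assume "x \<in> space N"
      from tendsto_power[OF tendsto_diff[OF tendsto_const lim[OF this], of "u x"], of 2]
      show "(\<lambda>i. (u x - U i x)\<^sup>2) \<longlonglongrightarrow> 0" by simp
    qed
    show "AE x in N. norm ((u x - U i x)\<^sup>2) \<le> 4 * (u x)\<^sup>2" for i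
    proof (rule AE_I2)
      fix x assume "x \<in> space N"
      from le[OF this, of i] have "\<bar>u x - U i x\<bar> \<le> \<bar>2 * u x\<bar>" by linarith
      then have "(u x - U i x)\<^sup>2 \<le> (2 * u x)\<^sup>2" by (simp only: abs_le_square_iff)
      then show "norm ((u x - U i x)\<^sup>2) \<le> 4 * (u x)\<^sup>2" by (simp add: power_mult_distrib)
    qed
  qed simp_all
  then have "(\<lambda>i. l2_norm N (\<lambda>x. u x - U i x)) \<longlonglongrightarrow> 0"
    unfolding l2_norm_def using tendsto_real_sqrt by fastforce
  then show "\<exists>h. l2_approx N D h \<and> l2_norm N (\<lambda>x. u x - h x) < e" if "e > 0" for e
    using eventually_happens'[OF sequentially_bot order_tendstoD(2)[OF _ that]] U by blast
qed

text \<open>The dense set consists of the rational combinations of indicators of sets in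
  \<open>C\<close>. Its closure contains the indicators of all measurable sets by Dynkin's theorem,
  then the nonnegative square-integrable functions by monotone limits, and finally differences of
  positive and negative parts.\<close>

lemma L2_separable:
  assumes fin: "finite_measure N" and C: "countable C" "Int_stable C" "C \<subseteq> Pow (space N)" "space N \<in> C"
    and gen: "sets N = sigma_sets (space N) C"
  obtains D where "countable D" "D \<subseteq> sq_integrable N"
    "\<And>g e. g \<in> sq_integrable N \<Longrightarrow> e > 0 \<Longrightarrow> \<exists>d\<in>D. l2_norm N (\<lambda>x. g x - d x) < e"
proof -
  interpret finite_measure N by (rule fin)
  \<comment> \<open>Encoding combinations as lists makes \<open>D\<close> the image of a countable
    set of lists, turns addition into concatenation and rational scaling into a map over the
    list.\<close>
  define S :: "(rat \<times> 'a set) list \<Rightarrow> 'a \<Rightarrow> real"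
    where "S L x = (\<Sum>(q, A)\<leftarrow>L. real_of_rat q * indicator A x)" for L x
  define D where "D = S ` {L. set L \<subseteq> UNIV \<times> C}"
  have ind: "indicator A \<in> sq_integrable N" if "A \<in> sets N" for A
    using that by (auto simp: sq_integrable_def power2_eq_square integrable_indicator_iff less_top[symmetric]
        simp flip: indicator_inter_arith)
  have DI: "S L \<in> D" if "set L \<subseteq> UNIV \<times> C" for L
    using that by (auto simp: D_def)
  have CN: "A \<in> sets N" if "A \<in> C" for A using that gen by auto
  have S0: "S [] = (\<lambda>x. 0)" and S1: "S ((q, A) # L) = (\<lambda>x. real_of_rat q * indicator A x + S L x)" for q A L
    by (auto simp: S_def)
  have "S L \<in> sq_integrable N" if "set L \<subseteq> UNIV \<times> C" for L
    using that
  proof (induction L)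
    case Nil then show ?case by (simp add: S0 sq_integrable_def)
  next
    case (Cons p L) then show ?case
      by (cases p) (auto simp: S1 intro!: sq_integrable_add sq_integrable_scale ind CN)
  qed
  then have D: "D \<subseteq> sq_integrable N" by (auto simp: D_def)
  have add: "(\<lambda>x. d x + d' x) \<in> D" if d: "d \<in> D" "d' \<in> D" for d d'
  proof -
    obtain L where L: "set L \<subseteq> UNIV \<times> C" "d = S L"
      using d(1) by (auto simp: D_def)
    obtain L' where L': "set L' \<subseteq> UNIV \<times> C" "d' = S L'"
      using d(2) by (auto simp: D_def)
    have "(\<lambda>x. d x + d' x) = S (L @ L')" by (simp add: L L' S_def fun_eq_iff)
    with L L' show ?thesis by (auto intro!: DI)
  qed
  have scale: "(\<lambda>x. real_of_rat r * d x) \<in> D" if d: "d \<in> D" for d r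
  proof -
    obtain L where L: "set L \<subseteq> UNIV \<times> C" "d = S L"
      using d by (auto simp: D_def)
    have "S (map (\<lambda>(q, A). (r * q, A)) L) = (\<lambda>x. real_of_rat r * S L x)"
      by (induction L) (auto simp: S0 S1 of_rat_mult algebra_simps)
    then have "(\<lambda>x. real_of_rat r * d x) = S (map (\<lambda>(q, A). (r * q, A)) L)" by (simp add: L)
    with L show ?thesis by (auto intro!: DI)
  qed
  have a_add: "l2_approx N D (\<lambda>x. g x + h x)" if "l2_approx N D g" "l2_approx N D h" for g h
    using l2_approx_add[OF D that] add by blast
  have a_scale: "l2_approx N D (\<lambda>x. c * g x)" if "l2_approx N D g" for g c
    using l2_approx_scale[OF D that] scale by blast
  note a_lim = l2_approx_limit[OF D]
  have a_diff: "l2_approx N D (\<lambda>x. g x - h x)" if "l2_approx N D g" "l2_approx N D h" for g h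
  proof -
    have "l2_approx N D (\<lambda>x. g x + (- 1) * h x)" by (rule a_add[OF that(1) a_scale[OF that(2)]])
    then show ?thesis by simp
  qed
  have a_D: "l2_approx N D d" if "d \<in> D" for d
  proof -
    have "l2_norm N (\<lambda>x. d x - d x) = 0" by (simp add: l2_norm_def)
    then have "\<exists>d'\<in>D. l2_norm N (\<lambda>x. d x - d' x) < e" if "e > 0" for e
      using that \<open>d \<in> D\<close> by (intro bexI[of _ d]) auto
    then show ?thesis using \<open>d \<in> D\<close> D by (simp add: l2_approx_def subsetD)
  qed
  have a_0: "l2_approx N D (\<lambda>_. 0)"
    using a_D[OF DI[of "[]"]] by (simp add: S0)
  have a_C: "l2_approx N D (indicator A)" if "A \<in> C" for A
  proof -
    have "S [(1, A)] = indicator A" by (auto simp: S_def)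
    with DI[of "[(1, A)]"] that show ?thesis by (auto intro!: a_D)
  qed
  \<comment> \<open>Since \<open>C\<close> is a pi-system, only complements and countable disjoint
    unions have to be treated.\<close>
  have a_set: "l2_approx N D (indicator A)" if "A \<in> sigma_sets (space N) C" for A
    using C(2,3) that
  proof (induction rule: sigma_sets_induct_disjoint)
    case (basic A) then show ?case by (rule a_C)
  next
    case empty
    show ?case using a_0 by simp
  next
    case (compl A)
    have i: "indicator (space N - A) \<in> sq_integrable N" using compl gen by (intro ind) auto
    show ?case
    \<comment> \<open>A constant sequence: \<open>a_lim\<close> compares the two functions on
      \<open>space N\<close> only.\<close>
    proof (rule a_lim[OF i, of "\<lambda>_ x. indicator (space N) x - indicator A x"])
      show "l2_approx N D (\<lambda>x. indicator (space N) x - indicator A x)"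
        by (rule a_diff[OF a_C[OF C(4)] compl(2)])
    qed (auto simp: indicator_def)
  next
    case (union A)
    have An: "A n \<in> sets N" for n unfolding gen using union(2) by blast
    have fin_union: "l2_approx N D (indicator (\<Union>i<n. A i))" for n :: nat
    proof (induction n)
      case 0
      show ?case using a_0 by simp
    next
      case (Suc n)
      have "(indicator (\<Union>i<Suc n. A i) :: 'a \<Rightarrow> real) = (\<lambda>x. indicator (\<Union>i<n. A i) x + indicator (A n) x)"
      proof (rule ext)
        fix x
        have "x \<notin> A i" if "x \<in> A n" "i < n" for i
          using disjoint_family_onD[OF union(1), of n i] that by auto
        then show "indicator (\<Union>i<Suc n. A i) x = (indicator (\<Union>i<n. A i) x + indicator (A n) x :: real)"
          by (auto simp: indicator_def less_Suc_eq)
      qed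
      with a_add[OF Suc union(3)[of n]] show ?case by simp
    qed
    show ?case
    proof (rule a_lim[OF ind fin_union])
      show "(\<Union>i. A i) \<in> sets N" using An by auto
      show "(\<lambda>n. indicator (\<Union>i<n. A i) x :: real) \<longlonglongrightarrow> indicator (\<Union>i. A i) x" for x
        by (rule LIMSEQ_indicator_UN)
      show "\<bar>indicator (\<Union>i<n. A i) x\<bar> \<le> \<bar>indicator (\<Union>i. A i) x :: real\<bar>" for n x
        by (auto simp: indicator_def)
    qed
  qed
  \<comment> \<open>Square integrability sits inside the induction formula because each stage must
    inherit it: summands and approximants are dominated by the function they build.\<close>
  have a_nonneg: "g \<in> sq_integrable N \<longrightarrow> l2_approx N D g"
    if "g \<in> borel_measurable N" "\<And>x. 0 \<le> g x" for g
    using that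
  proof (induction rule: borel_measurable_induct_real)
    case (set A)
    then have "A \<in> sigma_sets (space N) C" by (simp only: gen)
    then show ?case using a_set by simp
  next
    case (mult u c)
    show ?case
    proof
      assume *: "(\<lambda>x. c * u x) \<in> sq_integrable N"
      show "l2_approx N D (\<lambda>x. c * u x)"
      \<comment> \<open>For \<open>c = 0\<close> the product carries no information about the
        integrability of \<open>u\<close>.\<close>
      proof (cases "c = 0")
        case True
        with a_0 show ?thesis by simp
      next
        case False
        then have "u \<in> sq_integrable N"
          using sq_integrable_scale[OF *, of "1 / c"] by simp
        with mult show ?thesis by (auto intro: a_scale)
      qed
    qed
  next
    case (add u v)
    show ?case
    proof
      assume *: "(\<lambda>x. v x + u x) \<in> sq_integrable N"
      have "u \<in> sq_integrable N" "v \<in> sq_integrable N"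
        using add by (auto intro!: sq_integrable_bound[OF *])
      with add show "l2_approx N D (\<lambda>x. v x + u x)" by (auto intro: a_add)
    qed
  next
    case (seq U)
    show ?case
    proof
      assume *: "g \<in> sq_integrable N"
      have le: "\<bar>U i x\<bar> \<le> \<bar>g x\<bar>" if "x \<in> space N" for i x
        using incseq_le[of "\<lambda>i. U i x" "g x" i] seq that by (auto simp: incseq_def le_fun_def)
      have "l2_approx N D (U i)" for i
        using seq sq_integrable_bound[OF * _ le] by auto
      then show "l2_approx N D g" by (rule a_lim[OF *]) (use seq le in auto)
    qed
  qed
  have "l2_approx N D g" if g: "g \<in> sq_integrable N" for g
  proof -
    have [measurable]: "g \<in> borel_measurable N" using g by (simp add: sq_integrable_def)
    have "l2_approx N D (\<lambda>x. max 0 (g x))" "l2_approx N D (\<lambda>x. max 0 (- g x))"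
      by (auto intro!: a_nonneg[rule_format] sq_integrable_bound[OF g])
    from a_diff[OF this] have "l2_approx N D (\<lambda>x. max 0 (g x) - max 0 (- g x))" .
    moreover have "(\<lambda>x. max 0 (g x) - max 0 (- g x)) = g" by (auto simp: max_def)
    ultimately show ?thesis by simp
  qed
  moreover have "countable D"
    unfolding D_def lists_eq_set[symmetric] by (intro countable_image countable_lists countable_SIGMA C) auto
  ultimately show thesis using that D unfolding l2_approx_def by blast
qed

section \<open>Random functions as random elements of \<open>L\<^sup>2\<close>\<close>

text \<open>The map on paths under which \<open>l2_law\<close> is the image measure, null path
  included.\<close>

definition l2_embed :: "'a measure \<Rightarrow> ('a \<Rightarrow> real) \<Rightarrow> ('a \<Rightarrow> real) set" where
  "l2_embed N g = l2_class N (if g \<in> sq_integrable N then g else (\<lambda>_. 0))"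

lemma zero_sq_integrable [simp]: "(\<lambda>_. 0) \<in> sq_integrable N"
  by (simp add: sq_integrable_def)

lemma l2_embed_in_L2 [simp]: "l2_embed N g \<in> L2 N"
  by (simp add: l2_embed_def L2_def)

lemma sq_integrable_iff_nn_integral:
  assumes "g \<in> borel_measurable N"
  shows "g \<in> sq_integrable N \<longleftrightarrow> (\<integral>\<^sup>+x. ennreal ((g x)\<^sup>2) \<partial>N) < \<infinity>"
  using assms by (simp add: sq_integrable_def integrable_iff_bounded)

text \<open>If g - h is square integrable, then \<open>g\<close> and \<open>h\<close> are both in L2
  or both outside it; in the second case both are sent to the class of 0 and the left side vanishes.
  If g - h is not square integrable, the right side is infinite.\<close>

lemma l2_dist_embed_le:
  assumes [measurable]: "g \<in> borel_measurable N" "h \<in> borel_measurable N"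
  shows "ennreal ((l2_dist N (l2_embed N g) (l2_embed N h))\<^sup>2) \<le> (\<integral>\<^sup>+x. ennreal ((g x - h x)\<^sup>2) \<partial>N)"
proof (cases "(\<lambda>x. g x - h x) \<in> sq_integrable N")
  case False
  then have "(\<integral>\<^sup>+x. ennreal ((g x - h x)\<^sup>2) \<partial>N) = \<infinity>"
    by (subst (asm) sq_integrable_iff_nn_integral) (auto simp flip: less_top)
  then show ?thesis by simp
next
  case True
  have iff: "g \<in> sq_integrable N \<longleftrightarrow> h \<in> sq_integrable N"
    using sq_integrable_add[OF True, of h] sq_integrable_diff[OF _ True, of g] by auto
  show ?thesis
  proof (cases "g \<in> sq_integrable N")
    case g: True
    then have "l2_dist N (l2_embed N g) (l2_embed N h) = l2_norm N (\<lambda>x. g x - h x)"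
      using iff by (simp add: l2_embed_def l2_dist_class)
    then have "(l2_dist N (l2_embed N g) (l2_embed N h))\<^sup>2 = (LINT x|N. (g x - h x)\<^sup>2)"
      by (simp add: l2_norm_def)
    also have "ennreal \<dots> = (\<integral>\<^sup>+x. ennreal ((g x - h x)\<^sup>2) \<partial>N)"
      using True by (subst nn_integral_eq_integral) (auto simp: sq_integrable_def)
    finally show ?thesis by simp
  next
    case False
    then show ?thesis
      using iff by (simp add: l2_embed_def l2_dist_class) (simp add: l2_norm_def)
  qed
qed

text \<open>By separability every open set is a countable union of balls centred at classes of
  \<open>D\<close>, so it suffices that the distance to a fixed class depends measurably on the
  sample point. That distance is a parameter integral of a jointly measurable function.\<close>

lemma measurable_l2_embed:
  fixes g :: "'w \<Rightarrow> 'a \<Rightarrow> real"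
  assumes fin: "finite_measure N"
    and C: "countable C" "Int_stable C" "C \<subseteq> Pow (space N)" "space N \<in> C"
    and gen: "sets N = sigma_sets (space N) C"
    and g [measurable]: "(\<lambda>(\<omega>, x). g \<omega> x) \<in> borel_measurable (P \<Otimes>\<^sub>M N)"
  shows "(\<lambda>\<omega>. l2_embed N (g \<omega>)) \<in> measurable P (L2_borel N)"
proof -
  interpret finite_measure N by (rule fin)
  interpret L: Metric_space "L2 N" "l2_dist N" by (rule Metric_space_L2)
  obtain D where D: "countable D" "D \<subseteq> sq_integrable N"
    and dense: "\<And>g e. g \<in> sq_integrable N \<Longrightarrow> e > 0 \<Longrightarrow> \<exists>d\<in>D. l2_norm N (\<lambda>x. g x - d x) < e"
    using L2_separable[OF fin C gen] by metis
  have gm: "g \<omega> \<in> borel_measurable N" if "\<omega> \<in> space P" for \<omega>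
    using measurable_Pair2[OF g that] by simp
  have sm: "{\<omega> \<in> space P. g \<omega> \<in> sq_integrable N} \<in> sets P"
  proof -
    have "{\<omega> \<in> space P. (\<integral>\<^sup>+x. ennreal ((g \<omega> x)\<^sup>2) \<partial>N) < \<infinity>} \<in> sets P" by measurable
    also have "{\<omega> \<in> space P. (\<integral>\<^sup>+x. ennreal ((g \<omega> x)\<^sup>2) \<partial>N) < \<infinity>} = {\<omega> \<in> space P. g \<omega> \<in> sq_integrable N}"
      using sq_integrable_iff_nn_integral[OF gm] by auto
    finally show ?thesis .
  qed
  have dm: "(\<lambda>\<omega>. l2_dist N (l2_embed N (g \<omega>)) (l2_class N d)) \<in> borel_measurable P" if "d \<in> D" for d
  proof -
    have ds: "d \<in> sq_integrable N" using that D by auto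
    then have [measurable]: "d \<in> borel_measurable N" by (simp add: sq_integrable_def)
    have "(\<lambda>\<omega>. if g \<omega> \<in> sq_integrable N then sqrt (LINT x|N. (g \<omega> x - d x)\<^sup>2)
           else l2_norm N (\<lambda>x. 0 - d x)) \<in> borel_measurable P"
      by (intro measurable_If sm) measurable
    also have "(\<lambda>\<omega>. if g \<omega> \<in> sq_integrable N then sqrt (LINT x|N. (g \<omega> x - d x)\<^sup>2)
           else l2_norm N (\<lambda>x. 0 - d x)) = (\<lambda>\<omega>. l2_dist N (l2_embed N (g \<omega>)) (l2_class N d))"
      using ds by (auto simp: l2_embed_def l2_dist_class l2_norm_def)
    finally show ?thesis .
  qed
  have opens: "{U. openin L.mtopology U} \<subseteq> Pow (L2 N)" using openin_subset[of L.mtopology] by auto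
  show ?thesis
    unfolding L2_borel_def
  proof (rule measurable_sigma_sets[OF sets_measure_of[OF opens] opens])
    show "(\<lambda>\<omega>. l2_embed N (g \<omega>)) \<in> space P \<rightarrow> L2 N" by simp
    fix U assume "U \<in> {U. openin L.mtopology U}"
    then have U: "openin L.mtopology U" by simp
    define I where "I = {(d, n). d \<in> D \<and> L.mball (l2_class N d) (1 / real (Suc n)) \<subseteq> U}"
    have cI: "countable I"
      by (rule countable_subset[of _ "D \<times> UNIV"]) (auto simp: I_def D)
    have "(\<lambda>\<omega>. l2_embed N (g \<omega>)) -` U \<inter> space P =
        (\<Union>(d, n)\<in>I. {\<omega> \<in> space P. l2_dist N (l2_embed N (g \<omega>)) (l2_class N d) < 1 / real (Suc n)})"
    proof (intro Set.set_eqI iffI)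
      fix \<omega> assume "\<omega> \<in> (\<lambda>\<omega>. l2_embed N (g \<omega>)) -` U \<inter> space P"
      then have w: "\<omega> \<in> space P" "l2_embed N (g \<omega>) \<in> U" by auto
      then obtain r where r: "r > 0" "L.mball (l2_embed N (g \<omega>)) r \<subseteq> U"
        using U L.openin_mtopology by blast
      \<comment> \<open>Twice the small radius must stay below \<open>r\<close>: the ball around
        \<open>d\<close> contains the class of \<open>u\<close> and then lies inside the
        \<open>r\<close>-ball around it.\<close>
      obtain n where n: "2 / real (Suc n) < r"
        using reals_Archimedean[of "r / 2"] r by (auto simp: field_simps)
      obtain u where u: "u \<in> sq_integrable N" "l2_embed N (g \<omega>) = l2_class N u"
        using l2_embed_in_L2 L2_cases by metis
      obtain d where d: "d \<in> D" "l2_norm N (\<lambda>x. u x - d x) < 1 / real (Suc n)"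
        using dense[OF u(1), of "1 / real (Suc n)"] by auto
      have ds: "d \<in> sq_integrable N" using d D by auto
      have dist: "l2_dist N (l2_class N u) (l2_class N d) < 1 / real (Suc n)"
        using d ds u by (simp add: l2_dist_class)
      have "L.mball (l2_class N d) (1 / real (Suc n)) \<subseteq> L.mball (l2_class N u) r"
      proof
        fix V assume "V \<in> L.mball (l2_class N d) (1 / real (Suc n))"
        then have V: "V \<in> L2 N" "l2_dist N (l2_class N d) V < 1 / real (Suc n)" by auto
        have uL: "l2_class N u \<in> L2 N" "l2_class N d \<in> L2 N" using u ds by (auto simp: L2_def)
        have "l2_dist N (l2_class N u) V < 1 / real (Suc n) + 1 / real (Suc n)"
          using L.triangle[OF uL V(1)] dist V(2) by linarith
        then show "V \<in> L.mball (l2_class N u) r" using n V uL by auto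
      qed
      then have "(d, n) \<in> I" using r u d by (auto simp: I_def)
      then show "\<omega> \<in> (\<Union>(d, n)\<in>I. {\<omega> \<in> space P. l2_dist N (l2_embed N (g \<omega>)) (l2_class N d) < 1 / real (Suc n)})"
        using dist u w by (intro UN_I[of "(d, n)"]) auto
    next
      fix \<omega> assume "\<omega> \<in> (\<Union>(d, n)\<in>I. {\<omega> \<in> space P. l2_dist N (l2_embed N (g \<omega>)) (l2_class N d) < 1 / real (Suc n)})"
      then obtain d n where dn: "(d, n) \<in> I" "\<omega> \<in> space P"
        "l2_dist N (l2_embed N (g \<omega>)) (l2_class N d) < 1 / real (Suc n)"
        by blast
      moreover from this have "l2_class N d \<in> L2 N" using D by (auto simp: I_def L2_def)
      ultimately have "l2_embed N (g \<omega>) \<in> L.mball (l2_class N d) (1 / real (Suc n))"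
        by (simp add: L.commute)
      then show "\<omega> \<in> (\<lambda>\<omega>. l2_embed N (g \<omega>)) -` U \<inter> space P" using dn by (auto simp: I_def)
    qed
    also have "\<dots> \<in> sets P"
    proof (rule sets.countable_UN''[OF cI])
      fix i assume "i \<in> I"
      then obtain d n where i: "i = (d, n)" "d \<in> D" by (auto simp: I_def)
      have [measurable]: "(\<lambda>\<omega>. l2_dist N (l2_embed N (g \<omega>)) (l2_class N d)) \<in> borel_measurable P"
        by (rule dm[OF i(2)])
      show "(case i of (d, n) \<Rightarrow> {\<omega> \<in> space P. l2_dist N (l2_embed N (g \<omega>)) (l2_class N d) < 1 / real (Suc n)}) \<in> sets P"
        unfolding i by simp
    qed
    finally show "(\<lambda>\<omega>. l2_embed N (g \<omega>)) -` U \<inter> space P \<in> sets P" .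
  qed
qed

section \<open>Wasserstein distance bounds\<close>

text \<open>The integrand is arbitrary: a simple function below \<open>h\<close> pulls back to a
  measurable function below \<open>h\<close> composed with \<open>T\<close>. This allows the squared
  distance as integrand without establishing its measurability on the product.\<close>

lemma nn_integral_distr_le:
  assumes T: "T \<in> measurable M N"
  shows "(\<integral>\<^sup>+x. h x \<partial>distr M N T) \<le> (\<integral>\<^sup>+x. h (T x) \<partial>M)"
  unfolding nn_integral_def[of "distr M N T"]
proof (rule SUP_least)
  fix s assume "s \<in> {g. simple_function (distr M N T) g \<and> g \<le> h}"
  then have s: "simple_function (distr M N T) s" "s \<le> h" by auto
  then have "integral\<^sup>S (distr M N T) s = (\<integral>\<^sup>+x. s x \<partial>distr M N T)"
    by (simp add: nn_integral_eq_simple_integral)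
  also have "\<dots> = (\<integral>\<^sup>+x. s (T x) \<partial>M)"
    using borel_measurable_simple_function[OF s(1)] by (intro nn_integral_distr[OF T]) simp
  also have "\<dots> \<le> (\<integral>\<^sup>+x. h (T x) \<partial>M)"
    using s(2) by (intro nn_integral_mono) (auto simp: le_fun_def)
  finally show "integral\<^sup>S (distr M N T) s \<le> (\<integral>\<^sup>+x. h (T x) \<partial>M)" .
qed

lemma ennreal_sqrt_mono: "a \<le> b \<Longrightarrow> ennreal_sqrt a \<le> ennreal_sqrt b"
  by (auto simp: ennreal_sqrt_def top_unique less_top intro!: ennreal_leI enn2real_mono)

text \<open>Convergence to 0 makes \<open>F\<close> finite eventually, and there
  \<open>ennreal_sqrt\<close> is the continuous real square root.\<close>

lemma ennreal_sqrt_tendsto_0: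
  assumes "(F \<longlongrightarrow> 0) \<F>"
  shows "((\<lambda>m. ennreal_sqrt (F m)) \<longlongrightarrow> 0) \<F>"
proof -
  have "\<forall>\<^sub>F m in \<F>. F m < \<infinity>" using order_tendstoD(2)[OF assms, of \<infinity>] by simp
  then have ev: "\<forall>\<^sub>F m in \<F>. ennreal (sqrt (enn2real (F m))) = ennreal_sqrt (F m)"
    by eventually_elim (auto simp: ennreal_sqrt_def)
  have "((\<lambda>m. enn2real (F m)) \<longlongrightarrow> 0) \<F>"
    using tendsto_enn2real[of F 0] assms by simp
  then have "((\<lambda>m. ennreal (sqrt (enn2real (F m)))) \<longlongrightarrow> ennreal (sqrt 0)) \<F>"
    by (intro tendsto_ennrealI tendsto_real_sqrt)
  then show ?thesis using tendsto_cong[OF ev] by simp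
qed

text \<open>The bound comes from the independent coupling.\<close>

lemma W2_L2_le:
  assumes P: "prob_space P" and Q: "prob_space Q"
    and g: "(\<lambda>\<omega>. l2_embed N (g \<omega>)) \<in> measurable P (L2_borel N)"
    and h: "(\<lambda>\<omega>. l2_embed N (h \<omega>)) \<in> measurable Q (L2_borel N)"
  shows "W2_L2 N P g Q h \<le> ennreal_sqrt (\<integral>\<^sup>+(\<omega>, \<omega>').
      ennreal ((l2_dist N (l2_embed N (g \<omega>)) (l2_embed N (h \<omega>')))\<^sup>2) \<partial>(P \<Otimes>\<^sub>M Q))"
proof -
  interpret P: prob_space P by (rule P)
  interpret Q: prob_space Q by (rule Q)
  define A where "A = distr P (L2_borel N) (\<lambda>\<omega>. l2_embed N (g \<omega>))"
  define B where "B = distr Q (L2_borel N) (\<lambda>\<omega>. l2_embed N (h \<omega>))"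
  interpret A: prob_space A unfolding A_def by (rule P.prob_space_distr[OF g])
  interpret B: prob_space B unfolding B_def by (rule Q.prob_space_distr[OF h])
  interpret AB: pair_prob_space A B ..
  \<comment> \<open>The product of the two laws is an image of \<open>P \<Otimes>\<^sub>M Q\<close>,
    so the cost of the coupling can be estimated on the sample spaces.\<close>
  have AB: "A \<Otimes>\<^sub>M B = distr (P \<Otimes>\<^sub>M Q) (L2_borel N \<Otimes>\<^sub>M L2_borel N)
      (\<lambda>(\<omega>, \<omega>'). (l2_embed N (g \<omega>), l2_embed N (h \<omega>')))"
    unfolding A_def B_def
    by (rule pair_measure_distr[OF g h]) (use B.sigma_finite_measure_axioms in \<open>simp add: B_def\<close>)
  have law: "l2_law P N g = A" "l2_law Q N h = B"
    by (auto simp: A_def B_def l2_law_def l2_embed_def)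
  have snd: "distr (A \<Otimes>\<^sub>M B) B snd = B"
  proof (rule measure_eqI)
    fix E assume "E \<in> sets (distr (A \<Otimes>\<^sub>M B) B snd)"
    then have E: "E \<in> sets B" by simp
    then have "emeasure (distr (A \<Otimes>\<^sub>M B) B snd) E = emeasure (A \<Otimes>\<^sub>M B) (space A \<times> E)"
      by (auto simp: emeasure_distr space_pair_measure dest: sets.sets_into_space
          intro!: arg_cong2[where f = emeasure])
    also have "\<dots> = emeasure B E"
      using E by (simp add: B.emeasure_pair_measure_Times A.emeasure_space_1)
    finally show "emeasure (distr (A \<Otimes>\<^sub>M B) B snd) E = emeasure B E" .
  qed simp
  have "A \<Otimes>\<^sub>M B \<in> couplings A B"
    unfolding couplings_def
    using AB.prob_space_axioms B.distr_pair_fst[of A] snd by auto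
  then have "(INF \<pi>\<in>couplings A B. \<integral>\<^sup>+ (u, v). ennreal ((l2_dist N u v)\<^sup>2) \<partial>\<pi>)
      \<le> (\<integral>\<^sup>+ (u, v). ennreal ((l2_dist N u v)\<^sup>2) \<partial>(A \<Otimes>\<^sub>M B))"
    by (rule INF_lower)
  also have "\<dots> \<le> (\<integral>\<^sup>+ z. (case (case z of (\<omega>, \<omega>') \<Rightarrow> (l2_embed N (g \<omega>), l2_embed N (h \<omega>'))) of
      (u, v) \<Rightarrow> ennreal ((l2_dist N u v)\<^sup>2)) \<partial>(P \<Otimes>\<^sub>M Q))"
    unfolding AB by (rule nn_integral_distr_le) (use g h in measurable)
  also have "\<dots> = (\<integral>\<^sup>+(\<omega>, \<omega>').
      ennreal ((l2_dist N (l2_embed N (g \<omega>)) (l2_embed N (h \<omega>')))\<^sup>2) \<partial>(P \<Otimes>\<^sub>M Q))"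
    by (intro nn_integral_cong) auto
  finally show ?thesis
    unfolding W2_L2_def wasserstein2_def law by (rule ennreal_sqrt_mono)
qed

section \<open>Kriging residuals\<close>

text \<open>Entry \<open>j\<close> of the row vector k(x, X_n) K^{-1}: the factor with which the
  observation at node \<open>j\<close> enters the interpolant at \<open>x\<close>.\<close>

definition kriging_weight :: "('a \<Rightarrow> 'a \<Rightarrow> real) \<Rightarrow> 'a list \<Rightarrow> 'a \<Rightarrow> nat \<Rightarrow> real" where
  "kriging_weight k xs x j = (\<Sum>i<length xs. k x (xs ! i) * (gram_inv k xs $$ (i, j)))"

definition residual :: "('a \<Rightarrow> 'a \<Rightarrow> real) \<Rightarrow> 'a list \<Rightarrow> ('a \<Rightarrow> real) \<Rightarrow> 'a \<Rightarrow> real" where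
  "residual k xs g x = g x - (\<Sum>j<length xs. kriging_weight k xs x j * g (xs ! j))"

lemma scalar_prod_gram_inv:
  assumes "invertible_mat (gram k xs)" "dim_vec v = length xs"
  shows "scalar_prod (vec_of_list (map (k x) xs)) (gram_inv k xs *\<^sub>v v) =
    (\<Sum>j<length xs. kriging_weight k xs x j * vec_index v j)"
proof -
  have G: "dim_row (gram_inv k xs) = length xs" "dim_col (gram_inv k xs) = length xs"
    using gram_inv(1)[OF assms(1)] by auto
  have "scalar_prod (vec_of_list (map (k x) xs)) (gram_inv k xs *\<^sub>v v) =
      (\<Sum>i<length xs. k x (xs ! i) * (\<Sum>j<length xs. gram_inv k xs $$ (i, j) * vec_index v j))"
    using G assms(2) by (simp add: scalar_prod_def atLeast0LessThan vec_of_list_index)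
  also have "\<dots> = (\<Sum>i<length xs. \<Sum>j<length xs. k x (xs ! i) * gram_inv k xs $$ (i, j) * vec_index v j)"
    by (simp add: sum_distrib_left mult.assoc)
  also have "\<dots> = (\<Sum>j<length xs. \<Sum>i<length xs. k x (xs ! i) * gram_inv k xs $$ (i, j) * vec_index v j)"
    by (rule sum.swap)
  finally show ?thesis by (simp add: kriging_weight_def sum_distrib_right)
qed

text \<open>The update is affine in the path: the data \<open>y\<close> enter through a term free of
  \<open>g\<close>, which cancels when two updated paths are subtracted.\<close>

lemma pathwise_update_eq:
  assumes "invertible_mat (gram k xs)" "y \<in> carrier_vec (length xs)"
  shows "pathwise_update k xs y g x =
    residual k xs g x + (\<Sum>j<length xs. kriging_weight k xs x j * vec_index y j)"
proof -
  have "pathwise_update k xs y g x =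
      g x + (\<Sum>j<length xs. kriging_weight k xs x j * (vec_index y j - g (xs ! j)))"
    unfolding pathwise_update_def using assms
    by (subst scalar_prod_gram_inv) (auto simp: vec_of_list_index)
  then show ?thesis by (simp add: residual_def right_diff_distrib sum_subtractf)
qed

lemma post_cov_eq:
  assumes "invertible_mat (gram k xs)"
  shows "post_cov k xs x x' = residual k xs (\<lambda>z. k z x') x"
  unfolding post_cov_def residual_def
  using assms by (subst scalar_prod_gram_inv) (auto simp: vec_of_list_index)

text \<open>From K^{-1} K = I: interpolation is exact, at every \<open>x\<close>, for the kernel
  section of a node.\<close>

lemma kriging_weight_gram:
  assumes "invertible_mat (gram k xs)" "i < length xs"
  shows "(\<Sum>j<length xs. kriging_weight k xs x j * k (xs ! j) (xs ! i)) = k x (xs ! i)"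
proof -
  let ?n = "length xs" and ?G = "gram_inv k xs"
  have G: "?G \<in> carrier_mat ?n ?n" "?G * gram k xs = 1\<^sub>m ?n" using gram_inv[OF assms(1)] by auto
  have GK: "(\<Sum>j<?n. ?G $$ (a, j) * k (xs ! j) (xs ! i)) = (if a = i then 1 else 0)" if "a < ?n" for a
  proof -
    have "(?G * gram k xs) $$ (a, i) = (\<Sum>j<?n. ?G $$ (a, j) * k (xs ! j) (xs ! i))"
      using G(1) that assms(2) by (simp add: gram_def scalar_prod_def atLeast0LessThan)
    then show ?thesis using G(2) that assms(2) by simp
  qed
  have "(\<Sum>j<?n. kriging_weight k xs x j * k (xs ! j) (xs ! i)) =
      (\<Sum>j<?n. \<Sum>a<?n. k x (xs ! a) * (?G $$ (a, j) * k (xs ! j) (xs ! i)))"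
    by (simp add: kriging_weight_def sum_distrib_right mult.assoc)
  also have "\<dots> = (\<Sum>a<?n. \<Sum>j<?n. k x (xs ! a) * (?G $$ (a, j) * k (xs ! j) (xs ! i)))"
    by (rule sum.swap)
  also have "\<dots> = (\<Sum>a<?n. k x (xs ! a) * (if a = i then 1 else 0))"
    by (simp add: sum_distrib_left[symmetric] GK)
  also have "\<dots> = k x (xs ! i)" using assms(2) by (simp add: sum.delta if_distrib cong: if_cong)
  finally show ?thesis .
qed

text \<open>The signed measure representing the residual at \<open>x\<close>. It is indexed by
  points instead of list positions, so that coinciding points merge, and so that the finite-set sums
  in \<open>psd_kernel\<close> and \<open>gaussian_process\<close> apply directly.\<close>

definition residual_coeff :: "('a \<Rightarrow> 'a \<Rightarrow> real) \<Rightarrow> 'a list \<Rightarrow> 'a \<Rightarrow> 'a \<Rightarrow> real" where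
  "residual_coeff k xs x z = (if z = x then 1 else 0) -
     (\<Sum>j<length xs. if xs ! j = z then kriging_weight k xs x j else 0)"

lemma residual_eq_sum:
  "residual k xs g x = (\<Sum>z\<in>insert x (set xs). residual_coeff k xs x z * g z)"
proof -
  let ?S = "insert x (set xs)"
  have "(\<Sum>z\<in>?S. residual_coeff k xs x z * g z) =
     (\<Sum>z\<in>?S. if z = x then g z else 0) -
     (\<Sum>z\<in>?S. \<Sum>j<length xs. if xs ! j = z then kriging_weight k xs x j * g z else 0)"
    by (simp add: residual_coeff_def left_diff_distrib sum_subtractf sum_distrib_right
        if_distrib[of "\<lambda>a. a * _"] cong: if_cong)
  also have "(\<Sum>z\<in>?S. \<Sum>j<length xs. if xs ! j = z then kriging_weight k xs x j * g z else 0) =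
     (\<Sum>j<length xs. \<Sum>z\<in>?S. if xs ! j = z then kriging_weight k xs x j * g z else 0)"
    by (rule sum.swap)
  also have "\<dots> = (\<Sum>j<length xs. kriging_weight k xs x j * g (xs ! j))"
    by (intro sum.cong refl) (auto simp: sum.delta)
  finally show ?thesis by (simp add: residual_def sum.delta)
qed

text \<open>The residual of \<open>k(\<cdot>, z)\<close> vanishes at the nodes, so applying it to both arguments
  of \<open>k\<close> gives the same value as applying it to one of them.\<close>

lemma post_cov_quadratic:
  assumes inv: "invertible_mat (gram k xs)" and sym: "\<And>x x'. k x x' = k x' x"
  shows "(\<Sum>z\<in>insert x (set xs). \<Sum>z'\<in>insert x (set xs).
      residual_coeff k xs x z * residual_coeff k xs x z' * k z z') = post_cov k xs x x"
proof -
  let ?S = "insert x (set xs)" and ?c = "residual_coeff k xs x"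
  define r where "r z = residual k xs (k z) x" for z
  have "(\<Sum>z\<in>?S. \<Sum>z'\<in>?S. ?c z * ?c z' * k z z') = (\<Sum>z\<in>?S. ?c z * r z)"
    by (simp add: r_def residual_eq_sum sum_distrib_left mult.assoc)
  also have "\<dots> = residual k xs r x" by (simp add: residual_eq_sum)
  also have "\<dots> = r x - (\<Sum>j<length xs. kriging_weight k xs x j * r (xs ! j))"
    by (simp add: residual_def)
  also have "(\<Sum>j<length xs. kriging_weight k xs x j * r (xs ! j)) = 0"
  proof (intro sum.neutral ballI)
    fix i assume "i \<in> {..<length xs}"
    then have "r (xs ! i) = 0"
      using kriging_weight_gram[OF inv, of i x] sym[of "xs ! i"]
      by (simp add: r_def residual_def)
    then show "kriging_weight k xs x i * r (xs ! i) = 0" by simp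
  qed
  \<comment> \<open>Here the section fixes the first argument of \<open>k\<close>, whereas
    \<open>post_cov_eq\<close> fixes the second; symmetry reconciles them.\<close>
  also have "r x = post_cov k xs x x"
  proof -
    have "k x = (\<lambda>z. k z x)" using sym by auto
    then show ?thesis by (simp add: post_cov_eq[OF inv] r_def)
  qed
  finally show ?thesis by simp
qed

text \<open>By \<open>post_cov_quadratic\<close> the posterior variance is a value of the quadratic
  form of \<open>k\<close>.\<close>

lemma post_cov_nonneg:
  assumes "psd_kernel k" "invertible_mat (gram k xs)"
  shows "0 \<le> post_cov k xs x x"
proof -
  have "k x x' = k x' x" for x x' using assms(1) by (simp add: psd_kernel_def)
  moreover have "0 \<le> (\<Sum>z\<in>insert x (set xs). \<Sum>z'\<in>insert x (set xs).
      residual_coeff k xs x z * residual_coeff k xs x z' * k z z')"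
    using assms(1) unfolding psd_kernel_def by blast
  ultimately show ?thesis using post_cov_quadratic[OF assms(2), of x] by simp
qed

section \<open>Bounds in the reproducing kernel Hilbert space\<close>

context rkhs
begin

lemma ip_Cauchy_Schwarz:
  assumes g: "g \<in> H" and h: "h \<in> H"
  shows "(ip g h)\<^sup>2 \<le> ip g g * ip h h"
proof -
  have expand: "0 \<le> a\<^sup>2 * ip g g + 2 * a * b * ip g h + b\<^sup>2 * ip h h" for a b
  proof -
    have m: "(\<lambda>x. a * g x) \<in> H" "(\<lambda>x. b * h x) \<in> H" using scale g h by auto
    let ?u = "\<lambda>x. a * g x + b * h x"
    have u: "?u \<in> H" using add m by auto
    have l: "ip ?u w = a * ip g w + b * ip h w" if "w \<in> H" for w
      using ip_add[OF m that] ip_scale g h that by simp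
    have "ip ?u ?u = a * ip ?u g + b * ip ?u h"
      using l[OF u] ip_commute u g h by simp
    also have "\<dots> = a\<^sup>2 * ip g g + 2 * a * b * ip g h + b\<^sup>2 * ip h h"
      using l g h ip_commute[OF g h] by (simp add: power2_eq_square algebra_simps)
    finally show ?thesis using ip_nonneg[OF u] by simp
  qed
  show ?thesis
  proof (cases "ip g g = 0")
    case True
    then have "g = (\<lambda>_. 0)" using ip_eq_0[OF g] by simp
    then have "ip g h = 0" using ip_scale[OF zero h, of 0] by simp
    then show ?thesis using True by simp
  next
    case False
    then have pos: "ip g g > 0" using ip_nonneg[OF g] by simp
    \<comment> \<open>This is the squared norm of a g + b h for a = -<g,h> and b = <g,g>, the
      component of \<open>h\<close> orthogonal to \<open>g\<close> up to scaling.\<close>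
    have "0 \<le> ip g g * (ip g g * ip h h - (ip g h)\<^sup>2)"
      using expand[of "- ip g h" "ip g g"] by (simp add: power2_eq_square algebra_simps)
    then show ?thesis using pos by (simp add: zero_le_mult_iff)
  qed
qed

text \<open>Linearity extends the reproducing property: combinations of kernel sections are the
  Riesz representers of combinations of point evaluations.\<close>

lemma kernel_combination:
  assumes "finite S"
  shows "(\<lambda>x'. \<Sum>z\<in>S. c z * k x' z) \<in> H \<and>
    (\<forall>g\<in>H. ip g (\<lambda>x'. \<Sum>z\<in>S. c z * k x' z) = (\<Sum>z\<in>S. c z * g z))"
  using assms
proof (induction S rule: finite_induct)
  case empty
  have "ip g (\<lambda>_. 0) = 0" if "g \<in> H" for g
    using ip_scale[OF zero that, of 0] ip_commute[OF that zero] by simp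
  then show ?case using zero by simp
next
  case (insert s S)
  let ?h = "\<lambda>x'. \<Sum>z\<in>S. c z * k x' z" and ?ks = "\<lambda>x'. c s * k x' s"
  have h: "?h \<in> H" "\<And>g. g \<in> H \<Longrightarrow> ip g ?h = (\<Sum>z\<in>S. c z * g z)" using insert by auto
  have ks: "?ks \<in> H" by (rule scale[OF kernel_mem])
  have "ip g (\<lambda>x'. ?ks x' + ?h x') = c s * g s + (\<Sum>z\<in>S. c z * g z)" if g: "g \<in> H" for g
  proof -
    have "ip g (\<lambda>x'. ?ks x' + ?h x') = ip (\<lambda>x'. ?ks x' + ?h x') g"
      by (rule ip_commute[OF g add[OF ks h(1)]])
    also have "\<dots> = ip ?ks g + ip ?h g" by (rule ip_add[OF ks h(1) g])
    also have "ip ?ks g = c s * ip (\<lambda>x'. k x' s) g" by (rule ip_scale[OF kernel_mem g])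
    also have "\<dots> = c s * g s" using ip_commute[OF kernel_mem g] reproducing[OF g] by simp
    also have "ip ?h g = (\<Sum>z\<in>S. c z * g z)" using ip_commute[OF h(1) g] h(2)[OF g] by simp
    finally show ?thesis .
  qed
  with insert(1,2) add[OF ks h(1)] show ?case by simp
qed

text \<open>The residual at \<open>x\<close> is a combination of point evaluations. Its representer
  has squared norm equal to the quadratic form computed in \<open>post_cov_quadratic\<close>, and
  Cauchy-Schwarz concludes.\<close>

lemma residual_bound:
  assumes inv: "invertible_mat (gram k xs)" and sym: "\<And>x x'. k x x' = k x' x" and g: "g \<in> H"
  shows "(residual k xs g x)\<^sup>2 \<le> ip g g * post_cov k xs x x"
proof -
  let ?S = "insert x (set xs)" and ?c = "residual_coeff k xs x"
  let ?h = "\<lambda>x'. \<Sum>z\<in>?S. ?c z * k x' z"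
  have h: "?h \<in> H" "\<And>g. g \<in> H \<Longrightarrow> ip g ?h = (\<Sum>z\<in>?S. ?c z * g z)"
    using kernel_combination[of ?S ?c] by auto
  have "residual k xs g x = ip g ?h" using h(2)[OF g] by (simp add: residual_eq_sum)
  moreover have "ip ?h ?h = post_cov k xs x x"
    unfolding h(2)[OF h(1)] post_cov_quadratic[OF inv sym, symmetric]
    by (simp only: sum_distrib_left mult.assoc)
  ultimately show ?thesis using ip_Cauchy_Schwarz[OF g h(1)] by simp
qed

end

section \<open>Second moments of Gaussian processes\<close>

lemma nn_integral_normal_law_square:
  assumes "0 \<le> v"
  shows "(\<integral>\<^sup>+x. ennreal (x\<^sup>2) \<partial>normal_law 0 v) = ennreal v"
proof (cases "v = 0")
  case True then show ?thesis by (simp add: normal_law_def nn_integral_return)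
next
  case False
  then have v: "sqrt v > 0" using assms by simp
  \<comment> \<open>The even moment of order 2 * 1, namely 2! / (2 / v) = v.\<close>
  have b: "has_bochner_integral lborel (\<lambda>x. normal_density 0 (sqrt v) x * x\<^sup>2) v"
    using normal_moment_even[OF v, of 0 1] assms False by (simp add: fact_2)
  have "(\<integral>\<^sup>+x. ennreal (x\<^sup>2) \<partial>normal_law 0 v) =
      (\<integral>\<^sup>+x. ennreal (normal_density 0 (sqrt v) x * x\<^sup>2) \<partial>lborel)"
    using False by (simp add: normal_law_def nn_integral_density ennreal_mult')
  also have "\<dots> = ennreal (LINT x|lborel. normal_density 0 (sqrt v) x * x\<^sup>2)"
    using b by (intro nn_integral_eq_integral) (auto simp: has_bochner_integral_iff)
  finally show ?thesis using b by (simp add: has_bochner_integral_iff)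
qed

lemma gaussian_process_second_moment:
  assumes gp: "gaussian_process P f (\<lambda>_. 0) k" and k: "psd_kernel k" and S: "finite S"
  shows "(\<integral>\<^sup>+\<omega>. ennreal ((\<Sum>x\<in>S. c x * f \<omega> x)\<^sup>2) \<partial>P) =
    ennreal (\<Sum>x\<in>S. \<Sum>x'\<in>S. c x * c x' * k x x')"
proof -
  have [measurable]: "(\<lambda>\<omega>. f \<omega> x) \<in> borel_measurable P" for x
    using gp by (simp add: gaussian_process_def)
  have "(\<integral>\<^sup>+\<omega>. ennreal ((\<Sum>x\<in>S. c x * f \<omega> x)\<^sup>2) \<partial>P) =
      (\<integral>\<^sup>+t. ennreal (t\<^sup>2) \<partial>distr P borel (\<lambda>\<omega>. \<Sum>x\<in>S. c x * f \<omega> x))"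
    by (subst nn_integral_distr) auto
  also have "distr P borel (\<lambda>\<omega>. \<Sum>x\<in>S. c x * f \<omega> x) =
      normal_law 0 (\<Sum>x\<in>S. \<Sum>x'\<in>S. c x * c x' * k x x')"
    using gp S by (simp add: gaussian_process_def)
  also have "(\<integral>\<^sup>+t. ennreal (t\<^sup>2) \<partial>\<dots>) = ennreal (\<Sum>x\<in>S. \<Sum>x'\<in>S. c x * c x' * k x x')"
    using k S by (intro nn_integral_normal_law_square) (simp add: psd_kernel_def)
  finally show ?thesis .
qed

text \<open>Polarization: twice the product is (f x + f z)^2 - (f x)^2 - (f z)^2, and the second
  moments of linear combinations are known.\<close>

lemma gaussian_process_covariance:
  assumes gp: "gaussian_process P f (\<lambda>_. 0) k" and k: "psd_kernel k"
  shows "(LINT \<omega>|P. f \<omega> x * f \<omega> z) = k x z"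
proof -
  have m [measurable]: "(\<lambda>\<omega>. f \<omega> x) \<in> borel_measurable P" for x
    using gp by (simp add: gaussian_process_def)
  have sym: "k x z = k z x" for x z
    using k by (simp add: psd_kernel_def)
  have sq: "has_bochner_integral P (\<lambda>\<omega>. (\<Sum>x\<in>S. c x * f \<omega> x)\<^sup>2) (\<Sum>x\<in>S. \<Sum>x'\<in>S. c x * c x' * k x x')"
    if "finite S" for S c
  proof (rule has_bochner_integral_nn_integral)
    show "0 \<le> (\<Sum>x\<in>S. \<Sum>x'\<in>S. c x * c x' * k x x')"
      using k that by (simp add: psd_kernel_def)
  qed (use gaussian_process_second_moment[OF gp k that] in auto)
  have sq1: "has_bochner_integral P (\<lambda>\<omega>. (f \<omega> x)\<^sup>2) (k x x)" for x
    using sq[of "{x}" "\<lambda>_. 1"] by simp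
  show ?thesis
  \<comment> \<open>For equal points the set \<open>{x, z}\<close> collapses to a singleton, so its
    sum is no longer f x + f z.\<close>
  proof (cases "x = z")
    case True
    then show ?thesis using sq1[of x] by (simp add: has_bochner_integral_iff power2_eq_square)
  next
    case False
    have "has_bochner_integral P (\<lambda>\<omega>. (f \<omega> x + f \<omega> z)\<^sup>2) (k x x + 2 * k x z + k z z)"
      using sq[of "{x, z}" "\<lambda>_. 1"] False sym[of z x] by (simp add: algebra_simps)
    from has_bochner_integral_diff[OF has_bochner_integral_diff[OF this sq1[of x]] sq1[of z]]
    have "has_bochner_integral P (\<lambda>\<omega>. 2 * (f \<omega> x * f \<omega> z)) (2 * k x z)"
      by (simp add: power2_eq_square algebra_simps)
    then show ?thesis by (simp add: has_bochner_integral_iff)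
  qed
qed

lemma nn_integral_pair_add:
  assumes P: "prob_space P" and Q: "prob_space Q"
    and [measurable]: "A \<in> borel_measurable P" "B \<in> borel_measurable Q"
  shows "(\<integral>\<^sup>+(\<omega>, \<omega>'). A \<omega> + B \<omega>' \<partial>(P \<Otimes>\<^sub>M Q)) = (\<integral>\<^sup>+\<omega>. A \<omega> \<partial>P) + (\<integral>\<^sup>+\<omega>'. B \<omega>' \<partial>Q)"
proof -
  interpret P: prob_space P by (rule P)
  interpret Q: prob_space Q by (rule Q)
  have "(\<integral>\<^sup>+(\<omega>, \<omega>'). A \<omega> + B \<omega>' \<partial>(P \<Otimes>\<^sub>M Q)) = (\<integral>\<^sup>+\<omega>. \<integral>\<^sup>+\<omega>'. A \<omega> + B \<omega>' \<partial>Q \<partial>P)"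
    by (subst Q.nn_integral_fst[symmetric]) auto
  also have "\<dots> = (\<integral>\<^sup>+\<omega>. A \<omega> + (\<integral>\<^sup>+\<omega>'. B \<omega>' \<partial>Q) \<partial>P)"
    by (intro nn_integral_cong) (simp add: nn_integral_add Q.emeasure_space_1)
  also have "\<dots> = (\<integral>\<^sup>+\<omega>. A \<omega> \<partial>P) + (\<integral>\<^sup>+\<omega>'. B \<omega>' \<partial>Q)"
    by (simp add: nn_integral_add P.emeasure_space_1)
  finally show ?thesis .
qed

text \<open>The common shift \<open>b\<close> need not be square-integrable: if it is not, both shifted processes
  have no path in \<open>L\<^sup>2\<close> whenever the unshifted ones do.\<close>

lemma W2_L2_shift_le:
  assumes P: "prob_space P" and Q: "prob_space Q" and fin: "finite_measure N"
    and C: "countable C" "Int_stable C" "C \<subseteq> Pow (space N)" "space N \<in> C"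
    and gen: "sets N = sigma_sets (space N) C"
    and g [measurable]: "(\<lambda>(\<omega>, x). g \<omega> x) \<in> borel_measurable (P \<Otimes>\<^sub>M N)"
    and h [measurable]: "(\<lambda>(\<omega>, x). h \<omega> x) \<in> borel_measurable (Q \<Otimes>\<^sub>M N)"
    and b [measurable]: "b \<in> borel_measurable N"
  shows "W2_L2 N P (\<lambda>\<omega> x. g \<omega> x + b x) Q (\<lambda>\<omega> x. h \<omega> x + b x) \<le>
    ennreal_sqrt (2 * (\<integral>\<^sup>+x. \<integral>\<^sup>+\<omega>. ennreal ((g \<omega> x)\<^sup>2) \<partial>P \<partial>N) +
      2 * (\<integral>\<^sup>+\<omega>. \<integral>\<^sup>+x. ennreal ((h \<omega> x)\<^sup>2) \<partial>N \<partial>Q))"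
proof -
  interpret P: prob_space P by (rule P)
  interpret Q: prob_space Q by (rule Q)
  interpret N: finite_measure N by (rule fin)
  interpret PN: pair_sigma_finite P N ..
  define A where "A \<omega> = (\<integral>\<^sup>+x. ennreal ((g \<omega> x)\<^sup>2) \<partial>N)" for \<omega>
  define B where "B \<omega> = (\<integral>\<^sup>+x. ennreal ((h \<omega> x)\<^sup>2) \<partial>N)" for \<omega>
  have [measurable]: "A \<in> borel_measurable P" "B \<in> borel_measurable Q"
    unfolding A_def B_def by measurable
  have gw [measurable]: "g \<omega> \<in> borel_measurable N" if "\<omega> \<in> space P" for \<omega>
    using measurable_Pair2[OF g that] by simp
  have hw [measurable]: "h \<omega> \<in> borel_measurable N" if "\<omega> \<in> space Q" for \<omega>
    using measurable_Pair2[OF h that] by simp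
  have "W2_L2 N P (\<lambda>\<omega> x. g \<omega> x + b x) Q (\<lambda>\<omega> x. h \<omega> x + b x) \<le> ennreal_sqrt (\<integral>\<^sup>+(\<omega>, \<omega>').
      ennreal ((l2_dist N (l2_embed N (\<lambda>x. g \<omega> x + b x)) (l2_embed N (\<lambda>x. h \<omega>' x + b x)))\<^sup>2) \<partial>(P \<Otimes>\<^sub>M Q))"
    by (intro W2_L2_le P Q measurable_l2_embed[OF fin C gen]) measurable
  also have "\<dots> \<le> ennreal_sqrt (\<integral>\<^sup>+(\<omega>, \<omega>'). 2 * A \<omega> + 2 * B \<omega>' \<partial>(P \<Otimes>\<^sub>M Q))"
  proof (intro ennreal_sqrt_mono nn_integral_mono, clarify)
    fix \<omega> \<omega>' assume "(\<omega>, \<omega>') \<in> space (P \<Otimes>\<^sub>M Q)"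
    then have w: "\<omega> \<in> space P" "\<omega>' \<in> space Q" by (auto simp: space_pair_measure)
    have [measurable]: "g \<omega> \<in> borel_measurable N" "h \<omega>' \<in> borel_measurable N" using w gw hw by auto
    have "ennreal ((l2_dist N (l2_embed N (\<lambda>x. g \<omega> x + b x)) (l2_embed N (\<lambda>x. h \<omega>' x + b x)))\<^sup>2)
        \<le> (\<integral>\<^sup>+x. ennreal (((g \<omega> x + b x) - (h \<omega>' x + b x))\<^sup>2) \<partial>N)"
      by (rule l2_dist_embed_le) auto
    also have "\<dots> \<le> (\<integral>\<^sup>+x. 2 * ennreal ((g \<omega> x)\<^sup>2) + 2 * ennreal ((h \<omega>' x)\<^sup>2) \<partial>N)"
    proof (intro nn_integral_mono)
      fix x
      \<comment> \<open>The shift cancels, and the remaining inequality is (g + h)^2 \<ge> 0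
        rearranged.\<close>
      have "((g \<omega> x + b x) - (h \<omega>' x + b x))\<^sup>2 \<le> 2 * (g \<omega> x)\<^sup>2 + 2 * (h \<omega>' x)\<^sup>2"
        using zero_le_power2[of "g \<omega> x + h \<omega>' x"] by (simp add: power2_eq_square algebra_simps)
      then have "ennreal (((g \<omega> x + b x) - (h \<omega>' x + b x))\<^sup>2) \<le> ennreal (2 * (g \<omega> x)\<^sup>2 + 2 * (h \<omega>' x)\<^sup>2)"
        by (rule ennreal_leI)
      also have "\<dots> = 2 * ennreal ((g \<omega> x)\<^sup>2) + 2 * ennreal ((h \<omega>' x)\<^sup>2)"
        by (simp add: ennreal_plus ennreal_mult)
      finally show "ennreal (((g \<omega> x + b x) - (h \<omega>' x + b x))\<^sup>2)
          \<le> 2 * ennreal ((g \<omega> x)\<^sup>2) + 2 * ennreal ((h \<omega>' x)\<^sup>2)" .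
    qed
    also have "\<dots> = 2 * A \<omega> + 2 * B \<omega>'"
      by (simp add: A_def B_def nn_integral_add nn_integral_cmult)
    finally show "ennreal ((l2_dist N (l2_embed N (\<lambda>x. g \<omega> x + b x)) (l2_embed N (\<lambda>x. h \<omega>' x + b x)))\<^sup>2)
        \<le> 2 * A \<omega> + 2 * B \<omega>'" .
  qed
  also have "(\<integral>\<^sup>+(\<omega>, \<omega>'). 2 * A \<omega> + 2 * B \<omega>' \<partial>(P \<Otimes>\<^sub>M Q)) =
      2 * (\<integral>\<^sup>+\<omega>. A \<omega> \<partial>P) + 2 * (\<integral>\<^sup>+\<omega>. B \<omega> \<partial>Q)"
    by (subst nn_integral_pair_add[OF P Q]) (auto simp: nn_integral_cmult)
  \<comment> \<open>Tonelli is applied to \<open>g\<close> only: for the Gaussian process the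
    expectation is known at each fixed point, while for the linear model the bound will hold path by
    path.\<close>
  also have "(\<integral>\<^sup>+\<omega>. A \<omega> \<partial>P) = (\<integral>\<^sup>+x. \<integral>\<^sup>+\<omega>. ennreal ((g \<omega> x)\<^sup>2) \<partial>P \<partial>N)"
    unfolding A_def by (rule PN.Fubini'[symmetric]) measurable
  finally show ?thesis by (simp add: B_def)
qed

section \<open>Residuals of the prior processes\<close>

text \<open>The section is the parameter integral E[f x f z], so joint measurability of
  \<open>f\<close> carries over to it.\<close>

lemma kernel_measurable:
  assumes gp: "gaussian_process P f (\<lambda>_. 0) k" and k: "psd_kernel k"
    and [measurable]: "(\<lambda>(\<omega>, x). f \<omega> x) \<in> borel_measurable (P \<Otimes>\<^sub>M N)"
  shows "(\<lambda>x. k x z) \<in> borel_measurable N"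
proof -
  interpret prob_space P using gp by (simp add: gaussian_process_def)
  have [measurable]: "(\<lambda>\<omega>. f \<omega> z) \<in> borel_measurable P"
    using gp by (simp add: gaussian_process_def)
  have "(\<lambda>x. LINT \<omega>|P. f \<omega> x * f \<omega> z) \<in> borel_measurable N" by measurable
  then show ?thesis by (simp add: gaussian_process_covariance[OF gp k])
qed

lemma kriging_weight_measurable:
  assumes [measurable]: "\<And>z. (\<lambda>x. k x z) \<in> borel_measurable N"
  shows "(\<lambda>x. kriging_weight k xs x j) \<in> borel_measurable N"
  unfolding kriging_weight_def by measurable

lemma residual_measurable:
  assumes [measurable]: "\<And>z. (\<lambda>x. k x z) \<in> borel_measurable N"
    and [measurable]: "\<And>z. (\<lambda>\<omega>. g \<omega> z) \<in> borel_measurable P"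
    and [measurable]: "(\<lambda>(\<omega>, x). g \<omega> x) \<in> borel_measurable (P \<Otimes>\<^sub>M N)"
  shows "(\<lambda>(\<omega>, x). residual k xs (g \<omega>) x) \<in> borel_measurable (P \<Otimes>\<^sub>M N)"
proof -
  note [measurable] = kriging_weight_measurable[OF assms(1)]
  show ?thesis unfolding residual_def by measurable
qed

text \<open>The residual is a finite linear combination of values of \<open>f\<close>; its variance
  is the quadratic form of \<open>post_cov_quadratic\<close>.\<close>

lemma gaussian_process_residual:
  assumes gp: "gaussian_process P f (\<lambda>_. 0) k" and k: "psd_kernel k"
    and inv: "invertible_mat (gram k xs)"
  shows "(\<integral>\<^sup>+\<omega>. ennreal ((residual k xs (f \<omega>) x)\<^sup>2) \<partial>P) = ennreal (post_cov k xs x x)"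
proof -
  have "k x x' = k x' x" for x x' using k by (simp add: psd_kernel_def)
  then show ?thesis
    using gaussian_process_second_moment[OF gp k, of "insert x (set xs)" "residual_coeff k xs x"]
      post_cov_quadratic[OF inv, of x]
    by (simp only: residual_eq_sum finite_insert List.finite_set)
qed

lemma residual_sum:
  "residual k xs (\<lambda>z. \<Sum>i<l. c i * g i z) x = (\<Sum>i<l. c i * residual k xs (g i) x)"
proof -
  have "(\<Sum>j<length xs. kriging_weight k xs x j * (\<Sum>i<l. c i * g i (xs ! j))) =
      (\<Sum>j<length xs. \<Sum>i<l. c i * (kriging_weight k xs x j * g i (xs ! j)))"
    by (simp add: sum_distrib_left mult.left_commute)
  also have "\<dots> = (\<Sum>i<l. \<Sum>j<length xs. c i * (kriging_weight k xs x j * g i (xs ! j)))"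
    by (rule sum.swap)
  finally show ?thesis
    by (simp add: residual_def right_diff_distrib sum_subtractf sum_distrib_left)
qed

text \<open>The residual sees its argument only at \<open>x\<close> and at the nodes, so a basis
  function may be exchanged for an RKHS function agreeing with it on \<open>X\<close>.\<close>

lemma residual_cong:
  assumes "\<And>z. z \<in> insert x (set xs) \<Longrightarrow> g z = h z"
  shows "residual k xs g x = residual k xs h x"
  using assms by (simp add: residual_eq_sum)

lemma std_normal_second_moment:
  assumes "distributed Q lborel w (normal_density 0 1)"
  shows "(\<integral>\<^sup>+\<omega>. ennreal ((w \<omega>)\<^sup>2) \<partial>Q) = 1"
proof -
  have "(\<integral>\<^sup>+\<omega>. ennreal ((w \<omega>)\<^sup>2) \<partial>Q) =
      (\<integral>\<^sup>+t. ennreal (normal_density 0 1 t) * ennreal (t\<^sup>2) \<partial>lborel)"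
    by (rule distributed_nn_integral[OF assms, symmetric]) simp
  also have "\<dots> = (\<integral>\<^sup>+t. ennreal (t\<^sup>2) \<partial>normal_law 0 1)"
    by (simp add: normal_law_def nn_integral_density)
  also have "\<dots> = 1" by (simp add: nn_integral_normal_law_square)
  finally show ?thesis .
qed

theorem corollary9:
  fixes \<mu> :: "'a :: metric_space measure"
    and k :: "'a \<Rightarrow> 'a \<Rightarrow> real"
    and H :: "('a \<Rightarrow> real) set" and ip :: "('a \<Rightarrow> real) \<Rightarrow> ('a \<Rightarrow> real) \<Rightarrow> real"
    and X :: "'a set"
    and P :: "'w measure" and f :: "'w \<Rightarrow> 'a \<Rightarrow> real"
    and Q :: "'v measure" and \<phi> :: "nat \<Rightarrow> 'a \<Rightarrow> real" and l :: nat
    and f' :: "'v \<Rightarrow> 'a \<Rightarrow> real"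
    and xs :: "nat \<Rightarrow> 'a list" and y :: "nat \<Rightarrow> real Matrix.vec"
  assumes "sets \<mu> = sets borel"
    and "psd_kernel k" and "rkhs k H ip"
    and "compact X" and "emeasure \<mu> X < \<infinity>"
    and "gaussian_process P f (\<lambda>_. 0) k"
    and "(\<lambda>(\<omega>, x). f \<omega> x) \<in> borel_measurable (P \<Otimes>\<^sub>M \<mu>)"
    and "AE \<omega> in P. f \<omega> \<in> sq_integrable (restrict_space \<mu> X)"
    and "std_normal_blm Q l \<phi> f'"
    and "\<And>i. i < l \<Longrightarrow> lies_locally_in (\<phi> i) H X"
    and "\<And>m. distinct (xs m)" and "\<And>m. set (xs m) \<subseteq> X"
    and "\<And>m. invertible_mat (gram k (xs m))"
    and "\<And>m. y m \<in> carrier_vec (length (xs m))"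
    and "(\<lambda>m. SUP x\<in>X. ennreal (post_cov k (xs m) x x)) \<longlonglongrightarrow> 0"
  shows "(\<lambda>m. W2_L2 (restrict_space \<mu> X)
            P (\<lambda>\<omega>. pathwise_update k (xs m) (y m) (f \<omega>))
            Q (\<lambda>\<omega>. pathwise_update k (xs m) (y m) (f' \<omega>))) \<longlonglongrightarrow> 0"
proof -
  note borel = assms(1) and k = assms(2) and X = assms(4) and gp = assms(6)
    and xsX = assms(12) and inv = assms(13)
  interpret rkhs k H ip by (rule assms(3))
  have sym: "k x x' = k x' x" for x x' using k by (simp add: psd_kernel_def)
  define N where "N = restrict_space \<mu> X"
  define S where "S m = (SUP x\<in>X. ennreal (post_cov k (xs m) x x))" for m
  have S0: "S \<longlonglongrightarrow> 0" using assms(15) unfolding S_def .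
  have S_upper: "ennreal (post_cov k (xs m) x x) \<le> S m" if "x \<in> X" for x m
    unfolding S_def using that by (rule SUP_upper)

  \<comment> \<open>The finite measure on \<open>X\<close> and its countable generator\<close>
  have space\<mu>: "space \<mu> = UNIV" using sets_eq_imp_space_eq[OF borel] by simp
  have Xs: "X \<in> sets \<mu>" using X by (simp add: borel compact_imp_closed borel_closed)
  have spN: "space N = X" by (simp add: N_def space_restrict_space space\<mu>)
  have emN: "emeasure N (space N) = emeasure \<mu> X"
    unfolding spN unfolding N_def using Xs by (subst emeasure_restrict_space) (auto simp: space\<mu>)
  have fin: "finite_measure N" using assms(5) by (intro finite_measureI) (simp add: emN)
  have setsN: "sets N = sets (restrict_space borel X)"
    unfolding N_def by (simp add: sets_restrict_space borel)
  obtain C where C: "countable C" "Int_stable C" "C \<subseteq> Pow (space N)" "space N \<in> C"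
    and gen: "sets N = sigma_sets (space N) C"
    using compact_borel_generator[OF X] unfolding spN setsN by metis

  \<comment> \<open>Measurability of the Gaussian process and of the kernel\<close>
  have P: "prob_space P" and fP [measurable]: "\<And>z. (\<lambda>\<omega>. f \<omega> z) \<in> borel_measurable P"
    using gp by (auto simp: gaussian_process_def)
  have fN [measurable]: "(\<lambda>(\<omega>, x). f \<omega> x) \<in> borel_measurable (P \<Otimes>\<^sub>M N)"
  proof -
    have [measurable]: "(\<lambda>x. x) \<in> measurable N \<mu>"
      unfolding N_def by (rule measurable_restrict_space1) simp
    have "(\<lambda>(\<omega>, x). (\<omega>, x)) \<in> measurable (P \<Otimes>\<^sub>M N) (P \<Otimes>\<^sub>M \<mu>)" by measurable
    from measurable_compose[OF this assms(7)] show ?thesis by (simp add: case_prod_beta)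
  qed
  have kN [measurable]: "(\<lambda>x. k x z) \<in> borel_measurable N" for z
    by (rule kernel_measurable[OF gp k fN])
  note [measurable] = kriging_weight_measurable[OF kN]

  \<comment> \<open>The linear model and its representatives in the RKHS\<close>
  obtain w where Q: "prob_space Q"
    and w: "\<And>i. i < l \<Longrightarrow> distributed Q lborel (w i) (normal_density 0 1)"
    and f': "f' = (\<lambda>\<omega> x. \<Sum>i<l. w i \<omega> * \<phi> i x)"
    using assms(9) unfolding std_normal_blm_def by blast
  have wm [measurable]: "w i \<in> borel_measurable Q" if "i < l" for i
    using distributed_measurable[OF w[OF that]] by simp
  have "\<exists>\<psi>. \<forall>i<l. \<psi> i \<in> H \<and> (\<forall>x\<in>X. \<psi> i x = \<phi> i x)"
    using assms(10) unfolding lies_locally_in_def by (intro choice) auto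
  then obtain \<psi> where \<psi>: "\<And>i. i < l \<Longrightarrow> \<psi> i \<in> H"
      "\<And>i x. i < l \<Longrightarrow> x \<in> X \<Longrightarrow> \<psi> i x = \<phi> i x"
    by blast
  have res_bound: "(residual k (xs m) (\<phi> i) x)\<^sup>2 \<le> ip (\<psi> i) (\<psi> i) * post_cov k (xs m) x x"
    if "i < l" "x \<in> X" for i x m
  proof -
    have "residual k (xs m) (\<phi> i) x = residual k (xs m) (\<psi> i) x"
      using \<psi>(2)[OF that(1)] that(2) xsX[of m] by (intro residual_cong) auto
    with residual_bound[OF inv sym \<psi>(1)[OF that(1)]] show ?thesis by simp
  qed

  text \<open>On \<open>X\<close> the basis functions are pointwise limits of their kernel interpolants.\<close>

  have \<phi>N [measurable]: "\<phi> i \<in> borel_measurable N" if i: "i < l" for i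
  proof (rule borel_measurable_LIMSEQ_real)
    show "(\<lambda>x. \<Sum>j<length (xs m). kriging_weight k (xs m) x j * \<phi> i (xs m ! j)) \<in> borel_measurable N" for m
      by measurable
    fix x assume "x \<in> space N"
    then have x: "x \<in> X" by (simp add: spN)
    have "(\<lambda>m. ennreal (post_cov k (xs m) x x)) \<longlonglongrightarrow> 0"
      by (rule tendsto_sandwich[OF _ _ tendsto_const S0]) (use S_upper[OF x] in auto)
    then have "(\<lambda>m. post_cov k (xs m) x x) \<longlonglongrightarrow> 0"
      using tendsto_enn2real[of _ 0] by (fastforce simp: post_cov_nonneg[OF k inv])
    from tendsto_mult_right_zero[OF this, of "ip (\<psi> i) (\<psi> i)"]
    \<comment> \<open>The squared residual is squeezed between 0 and a fixed multiple of the
      posterior variance at \<open>x\<close>.\<close>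
    have "(\<lambda>m. (residual k (xs m) (\<phi> i) x)\<^sup>2) \<longlonglongrightarrow> 0"
      by (rule tendsto_sandwich[OF _ _ tendsto_const, rotated 2]) (use res_bound[OF i x] in auto)
    then have "(\<lambda>m. residual k (xs m) (\<phi> i) x) \<longlonglongrightarrow> 0" by simp
    from tendsto_diff[OF tendsto_const this, of "\<phi> i x"]
    show "(\<lambda>m. \<Sum>j<length (xs m). kriging_weight k (xs m) x j * \<phi> i (xs m ! j)) \<longlonglongrightarrow> \<phi> i x"
      by (simp add: residual_def)
  qed
  have f'Q [measurable]: "(\<lambda>\<omega>. f' \<omega> z) \<in> borel_measurable Q" for z
    unfolding f' by measurable
  have f'N [measurable]: "(\<lambda>(\<omega>, x). f' \<omega> x) \<in> borel_measurable (Q \<Otimes>\<^sub>M N)"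
    unfolding f' split_beta by (intro borel_measurable_sum borel_measurable_times) measurable

  define K where "K = (\<Sum>i<l. ip (\<psi> i) (\<psi> i))"
  have K: "K \<ge> 0" unfolding K_def by (intro sum_nonneg ip_nonneg \<psi>) auto
  \<comment> \<open>The random constant in the pathwise bound: Cauchy-Schwarz over the basis index
    splits the squared residual into the sum of squared weights and the sum of squared basis
    residuals. The latter is at most \<open>K\<close>, the total squared RKHS norm, times the
    posterior variance.\<close>
  define V where "V \<omega> = ennreal (\<Sum>i<l. (w i \<omega>)\<^sup>2) * ennreal K" for \<omega>
  have [measurable]: "V \<in> borel_measurable Q"
    unfolding V_def by measurable
  have VQ: "(\<integral>\<^sup>+\<omega>. V \<omega> \<partial>Q) = ennreal (real l * K)"
  proof -
    have "(\<integral>\<^sup>+\<omega>. V \<omega> \<partial>Q) = (\<integral>\<^sup>+\<omega>. (\<Sum>i<l. ennreal ((w i \<omega>)\<^sup>2)) \<partial>Q) * ennreal K"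
      unfolding V_def by (subst nn_integral_multc) (auto simp: sum_ennreal intro: wm)
    \<comment> \<open>Each of the \<open>l\<close> weights has second moment 1.\<close>
    also have "(\<integral>\<^sup>+\<omega>. (\<Sum>i<l. ennreal ((w i \<omega>)\<^sup>2)) \<partial>Q) = (\<Sum>i<l. 1)"
      by (subst nn_integral_sum) (auto simp: std_normal_second_moment[OF w] intro: wm)
    finally show ?thesis using K by (simp add: ennreal_mult ennreal_of_nat_eq_real_of_nat)
  qed
  have f'_bound: "ennreal ((residual k (xs m) (f' \<omega>) x)\<^sup>2) \<le> V \<omega> * S m" if x: "x \<in> X" for \<omega> x m
  proof -
    let ?p = "post_cov k (xs m) x x"
    have p: "?p \<ge> 0" by (rule post_cov_nonneg[OF k inv])
    have "(residual k (xs m) (f' \<omega>) x)\<^sup>2 = (\<Sum>i<l. w i \<omega> * residual k (xs m) (\<phi> i) x)\<^sup>2"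
      by (simp add: f' residual_sum)
    also have "\<dots> \<le> (\<Sum>i<l. (w i \<omega>)\<^sup>2) * (\<Sum>i<l. (residual k (xs m) (\<phi> i) x)\<^sup>2)"
      by (rule Cauchy_Schwarz_ineq_sum)
    also have "\<dots> \<le> (\<Sum>i<l. (w i \<omega>)\<^sup>2) * (K * ?p)"
      unfolding K_def sum_distrib_right
      by (intro mult_left_mono sum_mono res_bound x sum_nonneg) auto
    finally have "ennreal ((residual k (xs m) (f' \<omega>) x)\<^sup>2) \<le> ennreal ((\<Sum>i<l. (w i \<omega>)\<^sup>2) * (K * ?p))"
      by (rule ennreal_leI)
    also have "\<dots> = V \<omega> * ennreal ?p"
      unfolding V_def using K p by (simp add: ennreal_mult sum_nonneg mult.assoc)
    also have "\<dots> \<le> V \<omega> * S m" by (intro mult_left_mono S_upper x) simp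
    finally show ?thesis .
  qed

  \<comment> \<open>The quantitative bound and the limit\<close>
  define c where "c = 2 * emeasure \<mu> X + 2 * (ennreal (real l * K) * emeasure \<mu> X)"
  have c: "c < \<infinity>" using assms(5) by (simp add: c_def ennreal_mult_less_top)
  have bound: "W2_L2 N P (\<lambda>\<omega>. pathwise_update k (xs m) (y m) (f \<omega>))
      Q (\<lambda>\<omega>. pathwise_update k (xs m) (y m) (f' \<omega>)) \<le> ennreal_sqrt (c * S m)" for m
  proof -
    define b where "b x = (\<Sum>j<length (xs m). kriging_weight k (xs m) x j * vec_index (y m) j)" for x
    have bN: "b \<in> borel_measurable N" unfolding b_def by measurable
    have upd: "pathwise_update k (xs m) (y m) g = (\<lambda>x. residual k (xs m) g x + b x)" for g
      by (rule ext) (simp add: pathwise_update_eq[OF inv assms(14)] b_def)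
    have "(\<integral>\<^sup>+x. \<integral>\<^sup>+\<omega>. ennreal ((residual k (xs m) (f \<omega>) x)\<^sup>2) \<partial>P \<partial>N) \<le> (\<integral>\<^sup>+x. S m \<partial>N)"
      by (intro nn_integral_mono) (simp add: gaussian_process_residual[OF gp k inv] S_upper spN)
    then have 1: "(\<integral>\<^sup>+x. \<integral>\<^sup>+\<omega>. ennreal ((residual k (xs m) (f \<omega>) x)\<^sup>2) \<partial>P \<partial>N) \<le> S m * emeasure \<mu> X"
      by (simp add: emN)
    \<comment> \<open>The pathwise bound is constant in \<open>x\<close>, so integration over
      \<open>X\<close> contributes the factor \<open>emeasure \<mu> X\<close>, and the expectation
      turns \<open>V\<close> into l K.\<close>
    have "(\<integral>\<^sup>+\<omega>. \<integral>\<^sup>+x. ennreal ((residual k (xs m) (f' \<omega>) x)\<^sup>2) \<partial>N \<partial>Q)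
        \<le> (\<integral>\<^sup>+\<omega>. \<integral>\<^sup>+x. V \<omega> * S m \<partial>N \<partial>Q)"
      by (intro nn_integral_mono) (simp add: f'_bound spN)
    also have "\<dots> = ennreal (real l * K) * S m * emeasure \<mu> X"
      by (simp add: emN nn_integral_multc VQ mult.assoc)
    finally have 2: "(\<integral>\<^sup>+\<omega>. \<integral>\<^sup>+x. ennreal ((residual k (xs m) (f' \<omega>) x)\<^sup>2) \<partial>N \<partial>Q)
        \<le> ennreal (real l * K) * S m * emeasure \<mu> X" .
    have "W2_L2 N P (\<lambda>\<omega>. pathwise_update k (xs m) (y m) (f \<omega>))
        Q (\<lambda>\<omega>. pathwise_update k (xs m) (y m) (f' \<omega>)) \<le>
      ennreal_sqrt (2 * (\<integral>\<^sup>+x. \<integral>\<^sup>+\<omega>. ennreal ((residual k (xs m) (f \<omega>) x)\<^sup>2) \<partial>P \<partial>N) +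
        2 * (\<integral>\<^sup>+\<omega>. \<integral>\<^sup>+x. ennreal ((residual k (xs m) (f' \<omega>) x)\<^sup>2) \<partial>N \<partial>Q))"
      unfolding upd
      by (rule W2_L2_shift_le[OF P Q fin C gen residual_measurable[OF kN fP fN]
            residual_measurable[OF kN f'Q f'N] bN])
    also have "\<dots> \<le> ennreal_sqrt (2 * (S m * emeasure \<mu> X) + 2 * (ennreal (real l * K) * S m * emeasure \<mu> X))"
      by (intro ennreal_sqrt_mono add_mono mult_left_mono 1 2) auto
    also have "2 * (S m * emeasure \<mu> X) + 2 * (ennreal (real l * K) * S m * emeasure \<mu> X) = c * S m"
      by (simp add: c_def algebra_simps)
    finally show ?thesis .
  qed
  \<comment> \<open>Finiteness of \<open>c\<close> excludes the indeterminate product of infinity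
    and 0 in the limit.\<close>
  have lim: "(\<lambda>m. ennreal_sqrt (c * S m)) \<longlonglongrightarrow> 0"
    using ennreal_tendsto_cmult[OF _ S0, of c] c by (intro ennreal_sqrt_tendsto_0) simp
  show ?thesis
    by (rule tendsto_sandwich[OF _ _ tendsto_const lim])
      (rule always_eventually, use bound in \<open>simp add: N_def\<close>)+
qed

end
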